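(* Let $\mathcal{H}$ be a real Hilbert space, $\mathcal{C}\subset\mathcal{H}$ a nonempty closed convex set, and $h:\mathcal{C}\to\overline{\mathbb{R}}=[-\infty,+\infty]$ a proper, lower semicontinuous convex function. Assume that $\mathcal{T}:\mathcal{H}\to\mathcal{H}$ is $h$-strongly pseudomonotone on $\mathcal{C}$ with modulus $\mu>0$ and Lipschitz continuous with constant $\beta>0$, and let $0<\lambda<\dfrac{1}{1+\beta^2}$. Consider the dynamical system, with initial point $x_0\in\mathcal{H}$, $$\begin{cases} y(t)=\mathrm{prox}_{\lambda h}\big(x(t)-\lambda\mathcal{T}(x(t))\big),\\ \dot{x}(t)+x(t)=y(t)+\lambda\left[\mathcal{T}(x(t))-\mathcal{T}(y(t))\right],\\ x(0)=x_0.\end{cases}$$ Then the unique solution $\bar{c}\in\mathcal{C}$ of the mixed variational inequality $$\langle\mathcal{T}(\bar{c}),u-\bar{c}\rangle+h(u)-h(\bar{c})\ge0\quad\text{for all }u\in\mathcal{C},$$ which is also the equilibrium point of the dynamical system, is globally exponentially stable for all the solutions $x(t)$ of the system; that is, for every solution $x(t)$, $$\|x(t)-\bar{c}\|^2\le\|x(0)-\bar{c}\|^2e^{-\alpha t}\quad\text{for all }t\in[0,+\infty),$$ where $$\alpha=2\left[1-\lambda(1+\beta^2)\right]\left(\frac{\lambda\mu}{1+\lambda(\mu+\beta)}\right)^2.$$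
   Context: Proximal operator: for $\lambda>0$ and $u\in\mathcal{H}$, $\mathrm{prox}_{\lambda h}(u)=\operatorname{arg\,min}_{v\in\mathcal{C}}\{\lambda h(v)+\tfrac12\|u-v\|^2\}$. Proper: $h>-\infty$ everywhere and $\mathrm{dom}\,h=\{u: h(u)<+\infty\}$ is nonempty. Convex: $\mathrm{dom}\,h$ is convex and $h(\alpha u+(1-\alpha)v)\le\alpha h(u)+(1-\alpha)h(v)$ for $u,v\in\mathrm{dom}\,h$, $\alpha\in[0,1]$. $h$-strongly pseudomonotone on $\mathcal{C}$ with modulus $\mu>0$: for all $u,v\in\mathcal{C}$, $$\langle\mathcal{T}u,v-u\rangle+h(v)-h(u)\ge0\ \Longrightarrow\ \langle\mathcal{T}v,v-u\rangle+h(v)-h(u)\ge\mu\|u-v\|^2.$$ Here $u$ is understood to lie in $\mathrm{dom}\,h$, and likewise solutions of the mixed variational inequality lie in $\mathrm{dom}\,h$, so that no expression $\infty-\infty$ occurs. A solution of the system is a strong global solution: $x:[0,+\infty)\to\mathcal{H}$ is locally absolutely continuous (absolutely continuous on each $[0,\rho]$, $0<\rho<+\infty$), the differential equation holds for almost every $t\ge0$, and $x(0)=x_0$. Writing the system as $\dot{x}(t)=F(x(t))$ with $F(x)=p(x)-x+\lambda[\mathcal{T}(x)-\mathcal{T}(p(x))]$, $p(x)=\mathrm{prox}_{\lambda h}(x-\lambda\mathcal{T}(x))$, an equilibrium point is a point $\bar{c}$ with $F(\bar{c})=0$. An equilibrium point $\bar{c}$ is globally exponentially stable if there are constants $k>0$,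 $a>0$ such that $\|x(t)-\bar{c}\|\le k\|x(0)-\bar{c}\|e^{-at}$ for all $t\in[0,+\infty)$ and all solutions $x$ of the system. *)

theory Defs
  imports "HOL-Analysis.Analysis"
begin

text \<open>
  An extended-real function \<open>h\<close> defined on a set \<open>C\<close> is modelled by a total function
  \<open>h :: 'a \<Rightarrow> ereal\<close>; every notion below depends only on the values of \<open>h\<close> on \<open>C\<close>.
\<close>

definition eff_dom :: "'a set \<Rightarrow> ('a \<Rightarrow> ereal) \<Rightarrow> 'a set" where
  "eff_dom C h = {u \<in> C. h u < \<infinity>}"

definition proper_on :: "'a set \<Rightarrow> ('a \<Rightarrow> ereal) \<Rightarrow> bool" where
  "proper_on C h \<longleftrightarrow> (\<forall>u\<in>C. -\<infinity> < h u) \<and> eff_dom C h \<noteq> {}"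

definition ereal_convex_on :: "'a::real_vector set \<Rightarrow> ('a \<Rightarrow> ereal) \<Rightarrow> bool" where
  "ereal_convex_on C h \<longleftrightarrow>
     convex (eff_dom C h) \<and>
     (\<forall>u\<in>eff_dom C h. \<forall>v\<in>eff_dom C h. \<forall>a\<in>{0..1}.
        h (a *\<^sub>R u + (1 - a) *\<^sub>R v) \<le> ereal a * h u + ereal (1 - a) * h v)"

definition lower_semicont_on :: "'a::topological_space set \<Rightarrow> ('a \<Rightarrow> ereal) \<Rightarrow> bool" where
  "lower_semicont_on C h \<longleftrightarrow> (\<forall>u\<in>C. h u \<le> Liminf (at u within C) h)"

text \<open>
  For proper lower semicontinuous convex \<open>h\<close>, nonempty closed convex \<open>C\<close> in a Hilbert space
  and \<open>lam > 0\<close> the minimiser exists and is unique, so the choice made by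
  \<^const>\<open>arg_min_on\<close> is harmless.
\<close>

definition prox :: "'a::real_normed_vector set \<Rightarrow> real \<Rightarrow> ('a \<Rightarrow> ereal) \<Rightarrow> 'a \<Rightarrow> 'a" where
  "prox C lam h u = arg_min_on (\<lambda>v. ereal lam * h v + ereal (1/2 * (norm (u - v))\<^sup>2)) C"

text \<open>
  The point \<open>u\<close> ranges over the effective domain, so \<open>h u\<close> is finite and the differences below
  are never of the form \<open>\<infinity> - \<infinity>\<close>; \<open>h v = \<infinity>\<close> is allowed.
\<close>

definition strongly_pseudomonotone_wrt ::
    "'a::real_inner set \<Rightarrow> ('a \<Rightarrow> ereal) \<Rightarrow> ('a \<Rightarrow> 'a) \<Rightarrow> real \<Rightarrow> bool" where
  "strongly_pseudomonotone_wrt C h T mu \<longleftrightarrow>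
     (\<forall>u\<in>eff_dom C h. \<forall>v\<in>C.
        ereal (T u \<bullet> (v - u)) + h v - h u \<ge> 0 \<longrightarrow>
        ereal (T v \<bullet> (v - u)) + h v - h u \<ge> ereal (mu * (norm (u - v))\<^sup>2))"

definition mvi_solution :: "'a::real_inner set \<Rightarrow> ('a \<Rightarrow> ereal) \<Rightarrow> ('a \<Rightarrow> 'a) \<Rightarrow> 'a \<Rightarrow> bool" where
  "mvi_solution C h T c \<longleftrightarrow>
     c \<in> eff_dom C h \<and> (\<forall>u\<in>C. ereal (T c \<bullet> (u - c)) + h u - h c \<ge> 0)"

text \<open>The right-hand side of the forward-backward-forward system, solved for the derivative.\<close>

definition fbf_field ::
    "'a::real_inner set \<Rightarrow> ('a \<Rightarrow> ereal) \<Rightarrow> ('a \<Rightarrow> 'a) \<Rightarrow> real \<Rightarrow> 'a \<Rightarrow> 'a" where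
  "fbf_field C h T lam x =
     (let y = prox C lam h (x - lam *\<^sub>R T x) in y - x + lam *\<^sub>R (T x - T y))"

text \<open>
  Absolute continuity of a function on a compact interval; \<open>absolutely_continuous\<close> in
  HOL-Analysis is the unrelated notion for measures.
\<close>

definition abs_continuous_on :: "real \<Rightarrow> real \<Rightarrow> (real \<Rightarrow> 'a::real_normed_vector) \<Rightarrow> bool" where
  "abs_continuous_on a b f \<longleftrightarrow>
     (\<forall>e>0. \<exists>d>0. \<forall>(n::nat) l r.
        (\<forall>i<n. a \<le> l i \<and> l i \<le> r i \<and> r i \<le> b) \<and>
        disjoint_family_on (\<lambda>i. {l i<..<r i}) {..<n} \<and>
        (\<Sum>i<n. r i - l i) < d \<longrightarrow>
        (\<Sum>i<n. norm (f (r i) - f (l i))) < e)"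

text \<open>
  Strong global solutions of the autonomous equation \<open>x' = F x\<close>, \<open>x 0 = x0\<close>.  Only the values of
  \<open>x\<close> on \<open>{0..}\<close> are relevant.
\<close>

definition strong_global_solution ::
    "('a::real_normed_vector \<Rightarrow> 'a) \<Rightarrow> 'a \<Rightarrow> (real \<Rightarrow> 'a) \<Rightarrow> bool" where
  "strong_global_solution F x0 x \<longleftrightarrow>
     (\<forall>\<rho>>0. abs_continuous_on 0 \<rho> x) \<and>
     (AE t in lebesgue_on {0..}. (x has_vector_derivative F (x t)) (at t within {0..})) \<and>
     x 0 = x0"

definition equilibrium_point :: "('a::real_normed_vector \<Rightarrow> 'a) \<Rightarrow> 'a \<Rightarrow> bool" where
  "equilibrium_point F c \<longleftrightarrow> F c = 0"

definition globally_exponentially_stable :: "('a::real_normed_vector \<Rightarrow> 'a) \<Rightarrow> 'a \<Rightarrow> bool" where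
  "globally_exponentially_stable F c \<longleftrightarrow>
     equilibrium_point F c \<and>
     (\<exists>k>0. \<exists>a>0. \<forall>x0 x. strong_global_solution F x0 x \<longrightarrow>
        (\<forall>t\<ge>0. norm (x t - c) \<le> k * norm (x 0 - c) * exp (- a * t)))"

end

theory Submission
  imports Defs
begin

text \<open>
  Let \<open>y = prox(x - \<lambda> T x)\<close> and let \<open>F\<close> be the right-hand side of the system.  The variational
  characterisation of the proximal point, tested with the solution \<open>c\<close>, and strong
  pseudomonotonicity give \<open>\<langle>y - c, F x\<rangle> \<le> - \<lambda>\<mu> \<parallel>y - c\<parallel>\<^sup>2\<close>.  This yields both
  \<open>\<langle>x - c, F x\<rangle> \<le> - (1 - \<lambda>\<beta>) \<parallel>x - y\<parallel>\<^sup>2\<close> and the error bound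
  \<open>\<lambda>\<mu> \<parallel>x - c\<parallel> \<le> (1 + \<lambda>(\<mu> + \<beta>)) \<parallel>x - y\<parallel>\<close>, so \<open>exp (\<alpha> t) \<parallel>x t - c\<parallel>\<^sup>2\<close> has nonpositive
  derivative almost everywhere and, being absolutely continuous, is nonincreasing.

  A solution \<open>c\<close> of the inequality exists because the Minty sets
  \<open>{u. \<langle>T v, u - v\<rangle> + h u - h v + \<mu> \<parallel>u - v\<parallel>\<^sup>2 \<le> 0}\<close> are bounded, closed, convex and form a KKM
  family.  For convex sets the KKM principle follows from Klee's intersection theorem by
  separation, without Brouwer's theorem.
\<close>

section \<open>Intersection theorems for convex sets\<close>

text \<open>The difference set of \<open>S\<close> and \<open>T\<close> is compact, convex and
  misses 0. Its element \<open>z\<close> of least norm is the normal vector, and the squared norm of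
  \<open>z\<close> is a gap between the two sets in that direction.\<close>

lemma strict_separation_compact:
  fixes S T :: "'a::real_inner set"
  assumes "compact S" "convex S" "S \<noteq> {}" "compact T" "convex T" "T \<noteq> {}" "S \<inter> T = {}"
  obtains a b where "\<And>x. x \<in> S \<Longrightarrow> a \<bullet> x > b" "\<And>y. y \<in> T \<Longrightarrow> a \<bullet> y < b"
proof -
  let ?P = "\<Union>x\<in>S. \<Union>y\<in>T. {x - y}"
  have P: "?P = {x - y |x y. x \<in> S \<and> y \<in> T}"
    by blast
  have cP: "compact ?P"
    unfolding P by (rule compact_differences[OF assms(1,4)])
  have vP: "convex ?P"
    by (rule convex_differences[OF assms(2,5)])
  have "?P \<noteq> {}"
    using assms(3,6) by blast
  then obtain z where z: "z \<in> ?P" "\<And>w. w \<in> ?P \<Longrightarrow> norm z \<le> norm w"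
    using continuous_attains_inf[OF cP _ continuous_on_norm_id] by metis
  have "z \<noteq> 0"
    using z(1) assms(7) by auto
  have gap: "(norm z)\<^sup>2 \<le> z \<bullet> (x - y)" if "x \<in> S" "y \<in> T" for x y
  proof -
    have "(0 - z) \<bullet> ((x - y) - z) \<le> 0"
      by (rule any_closest_point_dot[OF vP compact_imp_closed[OF cP] z(1)])
        (use that z(2) in auto)
    then show ?thesis
      by (simp add: inner_diff_right power2_norm_eq_inner)
  qed
  obtain m where m: "m \<in> S" "\<And>x. x \<in> S \<Longrightarrow> z \<bullet> m \<le> z \<bullet> x"
    using continuous_attains_inf[OF assms(1,3), of "\<lambda>x. z \<bullet> x"]
      continuous_on_inner[OF continuous_on_const continuous_on_id] by metis
  have "(norm z)\<^sup>2 > 0"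
    using \<open>z \<noteq> 0\<close> by simp
  show thesis
  proof
    show "z \<bullet> x > z \<bullet> m - (norm z)\<^sup>2 / 2" if "x \<in> S" for x
      using m(2)[OF that] \<open>(norm z)\<^sup>2 > 0\<close> by linarith
    show "z \<bullet> y < z \<bullet> m - (norm z)\<^sup>2 / 2" if "y \<in> T" for y
      using gap[OF m(1) that] \<open>(norm z)\<^sup>2 > 0\<close> unfolding inner_diff_right by linarith
  qed
qed

text \<open>Were \<open>G n\<close> disjoint from the intersection over \<open>I\<close>, a
  hyperplane would separate them strictly. Cutting every other set with that hyperplane preserves
  the hypotheses, so induction puts a point of the intersection on the hyperplane, which is
  absurd.\<close>

lemma klee_intersection:
  fixes G :: "'b \<Rightarrow> 'a::real_inner set"
  assumes "finite I"
    and "\<And>i. i \<in> I \<Longrightarrow> compact (G i)" "\<And>i. i \<in> I \<Longrightarrow> convex (G i)"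
    and "convex (\<Union>i\<in>I. G i)" "(\<Union>i\<in>I. G i) \<noteq> {}"
    and "\<And>i. i \<in> I \<Longrightarrow> (\<Inter>j\<in>I - {i}. G j) \<noteq> {}"
  shows "(\<Inter>i\<in>I. G i) \<noteq> {}"
  using assms
proof (induction I arbitrary: G rule: finite_induct)
  case empty
  then show ?case by simp
next
  case (insert n I)
  show ?case
  proof (cases "I = {}")
    case True
    then show ?thesis using insert.prems(4) by simp
  next
    case False
    let ?D = "\<Inter>j\<in>I. G j"
    have "insert n I - {n} = I"
      using insert.hyps by auto
    then have Dne: "?D \<noteq> {}"
      using insert.prems(5)[of n] by simp
    obtain i0 where "i0 \<in> I"
      using False by blast
    then have Gne: "G n \<noteq> {}"
      using insert.prems(5)[of i0] insert.hyps by auto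
    have Dc: "compact ?D"
    proof -
      have "closed ?D"
        using insert.prems(1) compact_imp_closed by (intro closed_INT) auto
      then have "compact (G i0 \<inter> ?D)"
        using insert.prems(1)[of i0] \<open>i0 \<in> I\<close> by (intro compact_Int_closed) simp_all
      then show ?thesis
      proof -
        have "G i0 \<inter> ?D = ?D" using \<open>i0 \<in> I\<close> by blast
        with \<open>compact (G i0 \<inter> ?D)\<close> show ?thesis by simp
      qed
    qed
    have Dv: "convex ?D"
      using insert.prems(2) by (auto intro!: convex_INT)
    show ?thesis
    proof
      assume "(\<Inter>i\<in>insert n I. G i) = {}"
      then have "?D \<inter> G n = {}"
        by auto
      then obtain a b where ab: "\<And>x. x \<in> ?D \<Longrightarrow> a \<bullet> x > b" "\<And>y. y \<in> G n \<Longrightarrow> a \<bullet> y < b"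
        using strict_separation_compact[OF Dc Dv Dne
            insert.prems(1)[OF insertI1] insert.prems(2)[OF insertI1] Gne] by metis
      let ?H = "{x. a \<bullet> x = b}"
      obtain d e where d: "d \<in> ?D" and e: "e \<in> G n"
        using Dne Gne by blast
      have crossing: "\<exists>z\<in>E. a \<bullet> z = b" if "convex E" "x \<in> E" "y \<in> E" "a \<bullet> x > b" "a \<bullet> y < b"
        for E x y
        using connected_ivt_hyperplane[of E y x a b] that convex_connected[of E] by auto
      \<comment> \<open>\<open>G n\<close> lies strictly on one side of \<open>?H\<close>, so it
        drops out of the union, and convexity of the full union is inherited by the slice.\<close>
      have eq: "(\<Union>i\<in>I. G i \<inter> ?H) = (\<Union>i\<in>insert n I. G i) \<inter> ?H"
        using ab(2) by fastforce
      have "(\<Inter>i\<in>I. G i \<inter> ?H) \<noteq> {}"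
      proof (rule insert.IH)
        show "compact (G i \<inter> ?H)" if "i \<in> I" for i
          using insert.prems(1) that closed_hyperplane by (auto intro!: compact_Int_closed)
        show "convex (G i \<inter> ?H)" if "i \<in> I" for i
          using insert.prems(2) that convex_hyperplane by (auto intro!: convex_Int)
        show "convex (\<Union>i\<in>I. G i \<inter> ?H)"
          unfolding eq using insert.prems(3) convex_hyperplane by (intro convex_Int)
        have "\<exists>z\<in>(\<Union>i\<in>insert n I. G i). a \<bullet> z = b"
          by (rule crossing[OF insert.prems(3), of d e])
            (use d e ab \<open>i0 \<in> I\<close> in auto)
        then show "(\<Union>i\<in>I. G i \<inter> ?H) \<noteq> {}"
          unfolding eq by blast
        show "(\<Inter>j\<in>I - {i}. G j \<inter> ?H) \<noteq> {}" if i: "i \<in> I" for i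
        proof -
          obtain w where w: "w \<in> (\<Inter>j\<in>insert n I - {i}. G j)"
            using insert.prems(5)[of i] i by blast
          then have "w \<in> G n"
            using i insert.hyps by auto
          \<comment> \<open>The points \<open>d\<close> and \<open>w\<close> of this convex
            intersection lie on opposite sides of the hyperplane, \<open>w\<close> because it
            belongs to \<open>G n\<close>.\<close>
          have "\<exists>z\<in>(\<Inter>j\<in>I - {i}. G j). a \<bullet> z = b"
            by (rule crossing[of _ d w])
              (use d w ab \<open>w \<in> G n\<close> insert.prems(2) in \<open>auto intro!: convex_INT\<close>)
          then show ?thesis by blast
        qed
      qed
      then obtain z where "z \<in> (\<Inter>i\<in>I. G i \<inter> ?H)" by blast
      then have "z \<in> ?D" "a \<bullet> z = b"
        using \<open>i0 \<in> I\<close> by blast+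
      then show False
        using ab(1) by fastforce
    qed
  qed
qed

text \<open>The covering condition for \<open>V\<close> itself makes the union of the truncated sets
  equal to the hull, hence convex; for proper subsets, induction supplies the smaller intersections.
  These are the hypotheses of \<open>klee_intersection\<close>, and the finite hull provides
  compactness.\<close>

lemma convex_KKM:
  fixes V :: "'a::real_inner set"
  assumes "finite V" "V \<noteq> {}"
    and "\<And>v. v \<in> V \<Longrightarrow> closed (G v)" "\<And>v. v \<in> V \<Longrightarrow> convex (G v)"
    and "\<And>A. A \<subseteq> V \<Longrightarrow> convex hull A \<subseteq> (\<Union>a\<in>A. G a)"
  shows "\<exists>c\<in>convex hull V. \<forall>v\<in>V. c \<in> G v"
  using assms
proof (induction V rule: finite_psubset_induct)
  case (psubset V)
  let ?G = "\<lambda>v. G v \<inter> convex hull V"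
  have un: "(\<Union>v\<in>V. ?G v) = convex hull V"
    using psubset.prems(4)[of V] by auto
  have "(\<Inter>v\<in>V. ?G v) \<noteq> {}"
  proof (rule klee_intersection[OF psubset.hyps(1)])
    show "compact (?G v)" if "v \<in> V" for v
      using psubset.prems(2)[OF that] finite_imp_compact_convex_hull[OF psubset.hyps(1)]
      by (metis closed_Int_compact)
    show "convex (?G v)" if "v \<in> V" for v
      using psubset.prems(3)[OF that] by (auto intro: convex_Int)
    show "convex (\<Union>v\<in>V. ?G v)" "(\<Union>v\<in>V. ?G v) \<noteq> {}"
      unfolding un using psubset.prems(1) by auto
    show "(\<Inter>u\<in>V - {v}. ?G u) \<noteq> {}" if "v \<in> V" for v
    proof (cases "V - {v} = {}")
      case False
      have "\<exists>c\<in>convex hull (V - {v}). \<forall>u\<in>V - {v}. c \<in> G u"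
      proof (rule psubset.IH)
        show "convex hull A \<subseteq> (\<Union>a\<in>A. G a)" if "A \<subseteq> V - {v}" for A
          using psubset.prems(4)[of A] that by blast
      qed (use that False psubset.prems in auto)
      moreover have "convex hull (V - {v}) \<subseteq> convex hull V"
        by (rule hull_mono) auto
      ultimately show ?thesis
        by blast
    qed simp
  qed
  then show ?case
    using psubset.prems(1) by blast
qed

section \<open>Finite intersection property of closed convex sets in Hilbert space\<close>

lemma parallelogram_midpoint:
  fixes x y :: "'a::real_inner"
  shows "(norm (x - y))\<^sup>2 = 2 * (norm x)\<^sup>2 + 2 * (norm y)\<^sup>2 - 4 * (norm ((1/2) *\<^sub>R x + (1/2) *\<^sub>R y))\<^sup>2"
  by (simp add: power2_norm_eq_inner inner_add inner_diff inner_commute[of y x] field_simps)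

text \<open>
  Elements of nearly minimal norm in larger and larger finite intersections form a Cauchy
  sequence; this replaces weak compactness of bounded closed convex sets.
\<close>

lemma hilbert_closed_convex_fip:
  fixes K :: "'a::{real_inner, complete_space} set set"
  assumes cl: "\<And>S. S \<in> K \<Longrightarrow> closed S" and cv: "\<And>S. S \<in> K \<Longrightarrow> convex S"
    and "B \<in> K" "bounded B"
    and fip: "\<And>F. finite F \<Longrightarrow> F \<subseteq> K \<Longrightarrow> \<Inter>F \<noteq> {}"
  shows "\<Inter>K \<noteq> {}"
proof -
  \<comment> \<open>The squared distance from 0 to the intersection. Inserting \<open>B\<close>
    keeps the points in one bounded set, so the supremum \<open>M\<close> of these values is
    finite.\<close>
  define d where "d F = (INF x\<in>\<Inter>(insert B F). (norm x)\<^sup>2)" for F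
  define \<F> where "\<F> = {F. finite F \<and> F \<subseteq> K}"
  have ne: "\<Inter>(insert B F) \<noteq> {}" if "F \<in> \<F>" for F
    using fip[of "insert B F"] that \<open>B \<in> K\<close> by (auto simp: \<F>_def)
  obtain R where R: "\<And>x. x \<in> B \<Longrightarrow> norm x \<le> R"
    using \<open>bounded B\<close> bounded_iff by blast
  have d_le: "d F \<le> (norm x)\<^sup>2" if "x \<in> \<Inter>(insert B F)" for F x
    unfolding d_def using that by (intro cINF_lower bdd_belowI2[of _ 0]) auto
  have d_bdd: "d F \<le> R\<^sup>2" if F: "F \<in> \<F>" for F
  proof -
    obtain x where x: "x \<in> \<Inter>(insert B F)" using ne[OF F] by blast
    then have "(norm x)\<^sup>2 \<le> R\<^sup>2"
      using R[of x] by (intro power_mono) auto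
    then show ?thesis using d_le[OF x] by linarith
  qed
  define M where "M = (SUP F\<in>\<F>. d F)"
  have d_le_M: "d F \<le> M" if "F \<in> \<F>" for F
    unfolding M_def using that d_bdd by (intro cSUP_upper bdd_aboveI2) auto
  have near: "\<exists>x\<in>\<Inter>(insert B F). (norm x)\<^sup>2 < M + e" if "F \<in> \<F>" "e > 0" for F e
  proof -
    have "d F < M + e" using d_le_M that by fastforce
    then show ?thesis
      unfolding d_def using cINF_less_iff[OF ne[OF that(1)] bdd_belowI2[of _ 0], of "\<lambda>x. (norm x)\<^sup>2"]
      by simp
  qed
  have "{} \<in> \<F>" by (simp add: \<F>_def)
  have "\<exists>F\<in>\<F>. M - 1 / Suc n < d F" for n
  proof -
    have "M - 1 / Suc n < M" by simp
    then show ?thesis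
      using less_cSUP_iff[of \<F> d "M - 1 / Suc n", folded M_def] bdd_aboveI2[of \<F> d, OF d_bdd] \<open>{} \<in> \<F>\<close>
      by auto
  qed
  then obtain F where F: "\<And>n. F n \<in> \<F>" "\<And>n. M - 1 / Suc n < d (F n)"
    by metis
  \<comment> \<open>The unions make the intersections shrink as \<open>n\<close> grows, while
    \<open>G n\<close> still contains \<open>F n\<close>, whose value \<open>d (F n)\<close> is
    within \<open>1 / Suc n\<close> of \<open>M\<close>.\<close>
  define G where "G n = (\<Union>k\<le>n. F k)" for n
  have GF: "G n \<in> \<F>" for n
    using F(1) by (auto simp: G_def \<F>_def)
  \<comment> \<open>The midpoint stays in the intersection for \<open>F n\<close>, so its squared
    norm exceeds \<open>M - 1 / Suc n\<close>. In the parallelogram identity \<open>M\<close>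
    cancels and \<open>8 / Suc n\<close> remains.\<close>
  have close: "(norm (x - y))\<^sup>2 \<le> 8 / Suc n"
    if x: "x \<in> \<Inter>(insert B (G n))" "(norm x)\<^sup>2 < M + 1 / Suc n"
      and y: "y \<in> \<Inter>(insert B (G n))" "(norm y)\<^sup>2 < M + 1 / Suc n" for x y n
  proof -
    have "convex (\<Inter>(insert B (F n)))"
      using cv \<open>B \<in> K\<close> F(1)[of n] by (intro convex_Inter) (auto simp: \<F>_def)
    moreover have "x \<in> \<Inter>(insert B (F n))" "y \<in> \<Inter>(insert B (F n))"
      using x(1) y(1) by (auto simp: G_def)
    ultimately have "(1/2) *\<^sub>R x + (1/2) *\<^sub>R y \<in> \<Inter>(insert B (F n))"
      by (rule convexD) auto
    then have "M - 1 / Suc n < (norm ((1/2) *\<^sub>R x + (1/2) *\<^sub>R y))\<^sup>2"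
      using d_le F(2)[of n] by fastforce
    then show ?thesis
      using x(2) y(2) unfolding parallelogram_midpoint[of x y] by (simp add: field_simps)
  qed
  have "\<exists>x\<in>\<Inter>(insert B (G n)). (norm x)\<^sup>2 < M + 1 / Suc n" for n
    by (rule near[OF GF]) auto
  then obtain x where x: "\<And>n. x n \<in> \<Inter>(insert B (G n))" "\<And>n. (norm (x n))\<^sup>2 < M + 1 / Suc n"
    by metis
  have lim8: "(\<lambda>n. sqrt (8 / Suc n)) \<longlonglongrightarrow> 0"
    using tendsto_real_sqrt[OF LIMSEQ_Suc[OF lim_const_over_n[of "8::real"]]] by simp
  have close': "norm (u - v) \<le> sqrt (8 / Suc n)" if "(norm (u - v))\<^sup>2 \<le> 8 / Suc n" for u v :: 'a and n
    using that real_le_rsqrt by blast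
  have xmn: "norm (x m - x n) \<le> sqrt (8 / Suc n)" if "n \<le> m" for m n
  proof (rule close', rule close)
    show "x m \<in> \<Inter>(insert B (G n))"
      using x(1)[of m] that by (force simp: G_def)
    show "(norm (x m))\<^sup>2 < M + 1 / Suc n"
    proof -
      have "1 / real (Suc m) \<le> 1 / real (Suc n)"
        using that by (intro divide_left_mono) auto
      then show ?thesis
        using x(2)[of m] by linarith
    qed
  qed (use x in auto)
  have "Cauchy x"
  proof (rule CauchyI')
    fix e :: real assume "e > 0"
    then have "\<forall>\<^sub>F n in sequentially. sqrt (8 / Suc n) < e"
      using lim8 by (auto simp: order_tendsto_iff)
    then obtain N where N: "\<And>n. n \<ge> N \<Longrightarrow> sqrt (8 / Suc n) < e"
      by (auto simp: eventually_sequentially)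
    show "\<exists>M. \<forall>m\<ge>M. \<forall>n>m. dist (x m) (x n) < e"
    proof (intro exI allI impI)
      fix m n assume "m \<ge> N" "n > m"
      then show "dist (x m) (x n) < e"
        using N[of m] xmn[of m n] by (simp add: dist_norm norm_minus_commute)
    qed
  qed
  then obtain l where l: "x \<longlonglongrightarrow> l"
    using Cauchy_convergent convergent_def by blast
  have "l \<in> S" if "S \<in> K" for S
  proof -
    \<comment> \<open>Nearly minimal points \<open>y n\<close> chosen inside \<open>S\<close> as
      well are still comparable with \<open>x n\<close> by \<open>close\<close>, so they share the
      limit \<open>l\<close>, and closedness puts \<open>l\<close> in \<open>S\<close>.\<close>
    have "insert S (G n) \<in> \<F>" for n
      using GF[of n] that by (auto simp: \<F>_def)
    then have "\<exists>y\<in>\<Inter>(insert B (insert S (G n))). (norm y)\<^sup>2 < M + 1 / Suc n" for n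
      by (intro near) auto
    then obtain y where y: "\<And>n. y n \<in> \<Inter>(insert B (insert S (G n)))"
        "\<And>n. (norm (y n))\<^sup>2 < M + 1 / Suc n"
      by metis
    have "norm (y n - x n) \<le> sqrt (8 / Suc n)" for n
      by (rule close', rule close) (use x y in auto)
    then have "(\<lambda>n. y n - x n) \<longlonglongrightarrow> 0"
      by (intro Lim_null_comparison[OF _ lim8] always_eventually allI)
    then have "y \<longlonglongrightarrow> l"
      using Lim_transform[OF l] by blast
    moreover have "y n \<in> S" for n
      using y(1) by auto
    ultimately show ?thesis
      using cl[OF that] closed_sequentially by blast
  qed
  then show ?thesis by blast
qed

section \<open>Absolutely continuous functions with nonpositive derivative\<close>

lemma abs_continuous_on_imp_continuous_on:
  assumes "abs_continuous_on a b f"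
  shows "continuous_on {a..b} f"
  unfolding continuous_on_iff
proof (intro ballI allI impI)
  fix s e :: real assume s: "s \<in> {a..b}" and "e > 0"
  obtain d where "d > 0" and d: "\<And>(n::nat) l r. \<lbrakk>\<forall>i<n. a \<le> l i \<and> l i \<le> r i \<and> r i \<le> b;
      disjoint_family_on (\<lambda>i. {l i<..<r i}) {..<n}; (\<Sum>i<n. r i - l i) < d\<rbrakk>
      \<Longrightarrow> (\<Sum>i<n. norm (f (r i) - f (l i))) < e"
    using assms \<open>e > 0\<close> unfolding abs_continuous_on_def by meson
  have "dist (f s') (f s) < e" if s': "s' \<in> {a..b}" "dist s' s < d" for s'
  proof -
    have "(\<Sum>i<1::nat. norm (f (max s s') - f (min s s'))) < e"
      by (rule d[of 1 "\<lambda>_. min s s'" "\<lambda>_. max s s'"])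
        (use s s' in \<open>auto simp: disjoint_family_on_def dist_real_def\<close>)
    then show ?thesis
      by (auto simp: dist_norm max_def min_def norm_minus_commute split: if_splits)
  qed
  then show "\<exists>d>0. \<forall>s'\<in>{a..b}. dist s' s < d \<longrightarrow> dist (f s') (f s) < e"
    using \<open>d > 0\<close> by blast
qed

text \<open>The extra length \<open>v - u\<close> in the bound allows \<open>f\<close> to contain a
  smooth factor in time, such as an exponential weight. The given tolerance is shared equally
  between the variation of \<open>x\<close> and the total length.\<close>

lemma abs_continuous_on_subordinate:
  assumes x: "abs_continuous_on a b x"
    and f: "\<And>u v. a \<le> u \<Longrightarrow> u \<le> v \<Longrightarrow> v \<le> b \<Longrightarrow>
      norm (f v - f u) \<le> M * (norm (x v - x u) + (v - u))"
  shows "abs_continuous_on a b f"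
  unfolding abs_continuous_on_def
proof (intro allI impI)
  fix e :: real assume "e > 0"
  define M' where "M' = max M 1"
  have "M' > 0" "M \<le> M'" by (auto simp: M'_def)
  define e' where "e' = e / (2 * M')"
  have "e' > 0" using \<open>e > 0\<close> \<open>M' > 0\<close> by (simp add: e'_def)
  obtain d where "d > 0" and d: "\<And>(n::nat) l r. \<lbrakk>\<forall>i<n. a \<le> l i \<and> l i \<le> r i \<and> r i \<le> b;
      disjoint_family_on (\<lambda>i. {l i<..<r i}) {..<n}; (\<Sum>i<n. r i - l i) < d\<rbrakk>
      \<Longrightarrow> (\<Sum>i<n. norm (x (r i) - x (l i))) < e'"
    using x \<open>e' > 0\<close> unfolding abs_continuous_on_def by meson
  have "(\<Sum>i<n. norm (f (r i) - f (l i))) < e"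
    if *: "\<forall>i<n. a \<le> l i \<and> l i \<le> r i \<and> r i \<le> b"
      "disjoint_family_on (\<lambda>i. {l i<..<r i}) {..<n}" "(\<Sum>i<n. r i - l i) < min d e'"
    for n :: nat and l r
  proof -
    have "norm (f (r i) - f (l i)) \<le> M' * (norm (x (r i) - x (l i)) + (r i - l i))" if "i < n" for i
    proof -
      have "norm (f (r i) - f (l i)) \<le> M * (norm (x (r i) - x (l i)) + (r i - l i))"
        using f *(1) that by blast
      also have "\<dots> \<le> M' * (norm (x (r i) - x (l i)) + (r i - l i))"
        using *(1) that \<open>M \<le> M'\<close> by (intro mult_right_mono) (auto intro: add_nonneg_nonneg)
      finally show ?thesis .
    qed
    then have "(\<Sum>i<n. norm (f (r i) - f (l i))) \<le> (\<Sum>i<n. M' * (norm (x (r i) - x (l i)) + (r i - l i)))"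
      by (intro sum_mono) auto
    also have "\<dots> = M' * ((\<Sum>i<n. norm (x (r i) - x (l i))) + (\<Sum>i<n. r i - l i))"
      by (simp only: sum_distrib_left flip: sum.distrib)
    also have "\<dots> < M' * (e' + e')"
      using d[OF *(1,2)] *(3) \<open>M' > 0\<close> by (intro mult_strict_left_mono) auto
    also have "\<dots> = e"
      using \<open>M' > 0\<close> by (simp add: e'_def)
    finally show ?thesis .
  qed
  then show "\<exists>d>0. \<forall>(n::nat) l r. (\<forall>i<n. a \<le> l i \<and> l i \<le> r i \<and> r i \<le> b) \<and>
      disjoint_family_on (\<lambda>i. {l i<..<r i}) {..<n} \<and> (\<Sum>i<n. r i - l i) < d \<longrightarrow>
      (\<Sum>i<n. norm (f (r i) - f (l i))) < e"
    using \<open>d > 0\<close> \<open>e' > 0\<close> by (intro exI[of _ "min d e'"]) auto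
qed

text \<open>Split the increment at \<open>t\<close>: the error of linear approximation is at most
  \<open>e\<close> times the length of each piece, and the linear part \<open>D * (v - u)\<close> is
  nonpositive.\<close>

lemma has_real_derivative_nonpos_straddle:
  fixes f :: "real \<Rightarrow> real"
  assumes "(f has_real_derivative D) (at t within S)" "D \<le> 0" "e > 0"
  obtains r where "r > 0"
    "\<And>u v. \<lbrakk>u \<in> S; v \<in> S; u \<le> t; t \<le> v; \<bar>u - t\<bar> < r; \<bar>v - t\<bar> < r\<rbrakk> \<Longrightarrow> f v - f u \<le> e * (v - u)"
proof -
  have "(f has_derivative (*) D) (at t within S)"
    using assms(1) by (simp add: has_field_derivative_def)
  then obtain r where "r > 0"
    and r: "\<And>y. y \<in> S \<Longrightarrow> \<bar>y - t\<bar> < r \<Longrightarrow> \<bar>f y - f t - D * (y - t)\<bar> \<le> e * \<bar>y - t\<bar>"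
    using \<open>e > 0\<close> unfolding has_derivative_within_alt by (metis real_norm_def)
  have "f v - f u \<le> e * (v - u)" if "u \<in> S" "v \<in> S" "u \<le> t" "t \<le> v" "\<bar>u - t\<bar> < r" "\<bar>v - t\<bar> < r" for u v
  proof -
    have "f v - f t - D * (v - t) \<le> e * (v - t)" "- (f u - f t - D * (u - t)) \<le> e * (t - u)"
      using r[of v] r[of u] that by (simp_all add: abs_le_iff)
    moreover have "D * (v - t) \<le> 0" "D * (u - t) \<ge> 0"
      using that \<open>D \<le> 0\<close> by (auto intro: mult_nonpos_nonneg mult_nonpos_nonpos)
    ultimately show ?thesis
      by (simp add: algebra_simps)
  qed
  then show thesis using that \<open>r > 0\<close> by blast
qed

text \<open>
  A tagged division fine for a suitable gauge: tags off the null set contribute little because the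
  derivative is nonpositive there, tags on it because their intervals lie in an open set of small
  measure.
\<close>

lemma abs_continuous_on_AE_deriv_nonpos:
  fixes f :: "real \<Rightarrow> real"
  assumes "a \<le> b" and f: "abs_continuous_on a b f" and N: "N \<in> null_sets lebesgue"
    and deriv: "\<And>t. t \<in> {a..b} - N \<Longrightarrow> \<exists>D\<le>0. (f has_real_derivative D) (at t within {a..b})"
  shows "f b \<le> f a"
proof -
  have *: "f b - f a \<le> e * (b - a) + e" if "e > 0" for e
  proof -
    obtain d where "d > 0" and d: "\<And>(n::nat) l r. \<lbrakk>\<forall>i<n. a \<le> l i \<and> l i \<le> r i \<and> r i \<le> b;
        disjoint_family_on (\<lambda>i. {l i<..<r i}) {..<n}; (\<Sum>i<n. r i - l i) < d\<rbrakk>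
        \<Longrightarrow> (\<Sum>i<n. norm (f (r i) - f (l i))) < e"
      using f \<open>e > 0\<close> unfolding abs_continuous_on_def by meson
    \<comment> \<open>The exceptional set is covered by an open set of measure below the
      \<open>d\<close> of absolute continuity for tolerance \<open>e\<close>.\<close>
    obtain U where U: "open U" "N \<subseteq> U" "U - N \<in> lmeasurable" "emeasure lebesgue (U - N) < ennreal d"
      using sets_lebesgue_outer_open[of N d] N \<open>d > 0\<close> by blast
    have UN: "U - N \<union> N = U" using U(2) by blast
    have "emeasure lebesgue U = emeasure lebesgue (U - N)"
      using emeasure_Un_null_set[of "U - N" lebesgue N] U(3) N UN by auto
    then have U_small: "emeasure lebesgue U < ennreal d"
      using U(4) by simp
    have U_lm: "U \<in> lmeasurable"
      using U_small U(1) by (intro fmeasurableI) (auto simp: less_top[symmetric] intro: order.strict_trans)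
    have mU: "measure lebesgue U < d"
      using U_small U_lm by (simp add: emeasure_eq_measure2 ennreal_less_iff)
    have "\<exists>r>0. (t \<in> N \<longrightarrow> ball t r \<subseteq> U) \<and> (t \<in> {a..b} - N \<longrightarrow>
        (\<forall>u v. u \<in> {a..b} \<longrightarrow> v \<in> {a..b} \<longrightarrow> u \<le> t \<longrightarrow> t \<le> v \<longrightarrow> \<bar>u - t\<bar> < r \<longrightarrow> \<bar>v - t\<bar> < r \<longrightarrow>
          f v - f u \<le> e * (v - u)))" for t
    proof (cases "t \<in> N")
      case True
      then show ?thesis using U(1,2) open_contains_ball by blast
    next
      case False
      show ?thesis
      proof (cases "t \<in> {a..b}")
        case True
        then obtain D where "D \<le> 0" "(f has_real_derivative D) (at t within {a..b})"
          using deriv False by blast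
        then obtain r where "r > 0" "\<And>u v. \<lbrakk>u \<in> {a..b}; v \<in> {a..b}; u \<le> t; t \<le> v; \<bar>u - t\<bar> < r; \<bar>v - t\<bar> < r\<rbrakk>
            \<Longrightarrow> f v - f u \<le> e * (v - u)"
          using has_real_derivative_nonpos_straddle \<open>e > 0\<close> by blast
        then show ?thesis using False by blast
      qed (use False in \<open>auto intro: exI[of _ 1]\<close>)
    qed
    then obtain r where r0: "\<And>t. r t > 0" and rN: "\<And>t. t \<in> N \<Longrightarrow> ball t (r t) \<subseteq> U"
      and rD: "\<And>t u v. \<lbrakk>t \<in> {a..b} - N; u \<in> {a..b}; v \<in> {a..b}; u \<le> t; t \<le> v; \<bar>u - t\<bar> < r t;
        \<bar>v - t\<bar> < r t\<rbrakk> \<Longrightarrow> f v - f u \<le> e * (v - u)"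
      by metis
    have "gauge (\<lambda>t. ball t (r t))"
      by (intro gauge_ball_dependent allI r0)
    then obtain p where p: "p tagged_division_of {a..b}" and fine: "(\<lambda>t. ball t (r t)) fine p"
      using fine_division_exists_real by blast
    have K: "t \<in> {a..b}" "Inf K \<le> t" "t \<le> Sup K" "a \<le> Inf K" "Inf K \<le> Sup K" "Sup K \<le> b"
        "\<bar>Inf K - t\<bar> < r t" "\<bar>Sup K - t\<bar> < r t" "interior K = {Inf K<..<Sup K}" "K \<subseteq> ball t (r t)"
      if "(t, K) \<in> p" for t K
    proof -
      have "t \<in> K" "K \<subseteq> {a..b}" and cb: "\<exists>u v. K = cbox u v"
        using tagged_division_ofD(2,3,4)[OF p that] by blast+
      obtain u v where uv: "K = {u..v}" using cb by (auto simp: box_real)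
      then have "u \<le> v" using \<open>t \<in> K\<close> by auto
      show sub: "K \<subseteq> ball t (r t)"
        using fineD[OF fine that] .
      have "u \<in> K" "v \<in> K" using uv \<open>u \<le> v\<close> by auto
      then have "u \<in> ball t (r t)" "v \<in> ball t (r t)" "u \<in> {a..b}" "v \<in> {a..b}"
        using sub \<open>K \<subseteq> {a..b}\<close> by blast+
      then show "t \<in> {a..b}" "Inf K \<le> t" "t \<le> Sup K" "a \<le> Inf K" "Inf K \<le> Sup K" "Sup K \<le> b"
        "\<bar>Inf K - t\<bar> < r t" "\<bar>Sup K - t\<bar> < r t" "interior K = {Inf K<..<Sup K}"
        using \<open>u \<le> v\<close> \<open>t \<in> K\<close> \<open>K \<subseteq> {a..b}\<close> by (auto simp: uv dist_real_def)
    qed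
    have "finite p" using p by blast
    define p1 where "p1 = {z \<in> p. fst z \<notin> N}"
    define p2 where "p2 = {z \<in> p. fst z \<in> N}"
    have fin: "finite p1" "finite p2" and disj: "p1 \<inter> p2 = {}" and un: "p = p1 \<union> p2"
      using \<open>finite p\<close> by (auto simp: p1_def p2_def)
    let ?len = "\<lambda>z::real \<times> real set. Sup (snd z) - Inf (snd z)"
    let ?inc = "\<lambda>z::real \<times> real set. f (Sup (snd z)) - f (Inf (snd z))"
    have "(\<Sum>z\<in>p1. ?inc z) \<le> (\<Sum>z\<in>p1. e * ?len z)"
    proof (rule sum_mono)
      fix z assume "z \<in> p1"
      then have z: "(fst z, snd z) \<in> p" "fst z \<notin> N" by (auto simp: p1_def)
      then show "?inc z \<le> e * ?len z"
        using K[OF z(1)] by (intro rD[of "fst z"]) auto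
    qed
    also have "\<dots> \<le> (\<Sum>z\<in>p. e * ?len z)"
    proof (rule sum_mono2)
      show "0 \<le> e * ?len z" if "z \<in> p - p1" for z
        using K(5)[of "fst z" "snd z"] that \<open>e > 0\<close> by simp
    qed (use \<open>finite p\<close> in \<open>auto simp: p1_def\<close>)
    also have "\<dots> = e * (b - a)"
      using additive_tagged_division_1[OF \<open>a \<le> b\<close> p, of "\<lambda>x. x"]
      by (simp add: sum_distrib_left[symmetric] case_prod_beta)
    finally have sum1: "(\<Sum>z\<in>p1. ?inc z) \<le> e * (b - a)" .
    \<comment> \<open>Absolute continuity is stated for families indexed by an initial segment of
      the naturals, so the intervals tagged in \<open>N\<close> are enumerated.\<close>
    obtain q where q: "bij_betw q {..<card p2} p2"
      using ex_bij_betw_nat_finite[OF fin(2)] by (auto simp: atLeast0LessThan)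
    let ?l = "\<lambda>i. Inf (snd (q i))" and ?r = "\<lambda>i. Sup (snd (q i))"
    have qp: "(fst (q i), snd (q i)) \<in> p" "fst (q i) \<in> N" if "i < card p2" for i
      using bij_betwE[OF q] that by (auto simp: p2_def)
    have qint: "interior (snd (q i)) = {?l i<..<?r i}" if "i < card p2" for i
      using K(9)[OF qp(1)[OF that]] .
    have disjq: "disjoint_family_on (\<lambda>i. {?l i<..<?r i}) {..<card p2}"
      unfolding disjoint_family_on_def
    proof (intro ballI impI)
      fix i j assume ij: "i \<in> {..<card p2}" "j \<in> {..<card p2}" "i \<noteq> j"
      then have "q i \<noteq> q j"
        using q by (meson bij_betw_def inj_onD)
      then have "(fst (q i), snd (q i)) \<noteq> (fst (q j), snd (q j))"
        by simp
      then have "interior (snd (q i)) \<inter> interior (snd (q j)) = {}"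
        using tagged_division_ofD(5)[OF p qp(1) qp(1)] ij by (metis lessThan_iff)
      then show "{?l i<..<?r i} \<inter> {?l j<..<?r j} = {}"
        using ij qint by auto
    qed
    \<comment> \<open>The interiors are disjoint and contained in \<open>U\<close>, so their total
      length is at most the measure of \<open>U\<close>.\<close>
    have "(\<Sum>i<card p2. ?r i - ?l i) = (\<Sum>i<card p2. measure lebesgue {?l i<..<?r i})"
      by (intro sum.cong refl) (use K(5)[OF qp(1)] in auto)
    also have "\<dots> = measure lebesgue (\<Union>i<card p2. {?l i<..<?r i})"
      using disjq by (intro measure_UNION'[symmetric])
        (auto simp: disjoint_family_on_def pairwise_def disjnt_def)
    also have "\<dots> \<le> measure lebesgue U"
    proof (rule measure_mono_fmeasurable[OF _ _ U_lm])
      have "{?l i<..<?r i} \<subseteq> U" if "i < card p2" for i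
        using qint[OF that] interior_subset[of "snd (q i)"] K(10)[OF qp(1)[OF that]] rN[OF qp(2)[OF that]]
        by (metis order.trans)
      then show "(\<Union>i<card p2. {?l i<..<?r i}) \<subseteq> U"
        by blast
    qed auto
    finally have "(\<Sum>i<card p2. ?r i - ?l i) < d"
      using mU by simp
    moreover have "\<forall>i<card p2. a \<le> ?l i \<and> ?l i \<le> ?r i \<and> ?r i \<le> b"
      using K(4,5,6)[OF qp(1)] by blast
    ultimately have "(\<Sum>i<card p2. norm (f (?r i) - f (?l i))) < e"
      using disjq by (intro d)
    moreover have "(\<Sum>i<card p2. norm (f (?r i) - f (?l i))) = (\<Sum>z\<in>p2. norm (?inc z))"
      using sum.reindex_bij_betw[OF q, of "\<lambda>z. norm (?inc z)"] by simp
    moreover have "(\<Sum>z\<in>p2. ?inc z) \<le> (\<Sum>z\<in>p2. norm (?inc z))"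
      by (intro sum_mono) auto
    ultimately have sum2: "(\<Sum>z\<in>p2. ?inc z) \<le> e"
      by linarith
    have "f b - f a = (\<Sum>z\<in>p. ?inc z)"
      using additive_tagged_division_1[OF \<open>a \<le> b\<close> p, of f] by (simp add: case_prod_beta)
    also have "\<dots> = (\<Sum>z\<in>p1. ?inc z) + (\<Sum>z\<in>p2. ?inc z)"
      unfolding un using fin disj by (rule sum.union_disjoint)
    finally show ?thesis using sum1 sum2 by linarith
  qed
  show ?thesis
  proof (rule field_le_epsilon)
    fix e :: real assume "e > 0"
    then have "f b - f a \<le> e / (b - a + 1) * (b - a) + e / (b - a + 1)"
      using \<open>a \<le> b\<close> by (intro *) auto
    also have "\<dots> = e / (b - a + 1) * (b - a + 1)"
      by (simp only: distrib_left mult_1_right)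
    also have "\<dots> = e"
      using \<open>a \<le> b\<close> by simp
    finally show "f b \<le> f a + e" by simp
  qed
qed

text \<open>The weight \<open>exp (\<alpha> * s)\<close> is chosen so that \<open>diss\<close>
  exactly absorbs its derivative in the product rule for \<open>f\<close>.\<close>

lemma strong_global_solution_exp_decay:
  fixes F :: "'a::real_inner \<Rightarrow> 'a"
  assumes x: "strong_global_solution F x0 x"
    and diss: "\<And>z. (z - c) \<bullet> F z \<le> - (\<alpha> / 2) * (norm (z - c))\<^sup>2"
    and "\<alpha> \<ge> 0" "t \<ge> 0"
  shows "(norm (x t - c))\<^sup>2 \<le> (norm (x 0 - c))\<^sup>2 * exp (- \<alpha> * t)"
proof (cases "t = 0")
  case False
  then have "t > 0" using \<open>t \<ge> 0\<close> by simp
  define f where "f s = exp (\<alpha> * s) * ((x s - c) \<bullet> (x s - c))" for s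
  have ac: "abs_continuous_on 0 t x"
    using x \<open>t > 0\<close> by (simp add: strong_global_solution_def)
  \<comment> \<open>The bounds \<open>B\<close> on the trajectory and \<open>E\<close> on the weight
    make the increments of the product \<open>f\<close> subordinate to those of \<open>x\<close> and
    of time.\<close>
  have "compact ((\<lambda>s. x s - c) ` {0..t})"
    by (intro compact_continuous_image continuous_intros abs_continuous_on_imp_continuous_on[OF ac]) auto
  then obtain B where "B > 0" and B: "\<And>s. s \<in> {0..t} \<Longrightarrow> norm (x s - c) \<le> B"
    using compact_imp_bounded bounded_pos by (metis imageI)
  define E where "E = exp (\<alpha> * t)"
  have E: "exp (\<alpha> * s) \<le> E" if "s \<le> t" for s
    using that \<open>\<alpha> \<ge> 0\<close> by (simp add: E_def mult_left_mono)
  have "abs_continuous_on 0 t f"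
  proof (rule abs_continuous_on_subordinate[OF ac])
    fix u v assume uv: "0 \<le> u" "u \<le> v" "v \<le> t"
    have exp_diff: "\<bar>exp (\<alpha> * v) - exp (\<alpha> * u)\<bar> \<le> E * \<alpha> * (v - u)"
    proof -
      \<comment> \<open>The tangent inequality of the exponential replaces the mean value theorem in
        estimating the increment of the weight.\<close>
      have "\<alpha> * u - \<alpha> * v + 1 \<le> exp (\<alpha> * u - \<alpha> * v)"
        using exp_ge_add_one_self[of "\<alpha> * u - \<alpha> * v"] by linarith
      then have "exp (\<alpha> * v) * (1 - exp (\<alpha> * u - \<alpha> * v)) \<le> exp (\<alpha> * v) * (\<alpha> * (v - u))"
        by (intro mult_left_mono) (auto simp: algebra_simps)
      also have "\<dots> \<le> E * (\<alpha> * (v - u))"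
        using E uv \<open>\<alpha> \<ge> 0\<close> by (intro mult_right_mono) auto
      finally have "exp (\<alpha> * v) - exp (\<alpha> * u) \<le> E * \<alpha> * (v - u)"
        by (simp add: algebra_simps flip: exp_add)
      moreover have "exp (\<alpha> * u) \<le> exp (\<alpha> * v)"
        using uv \<open>\<alpha> \<ge> 0\<close> by (simp add: mult_left_mono)
      ultimately show ?thesis by simp
    qed
    have sq_diff: "\<bar>(x v - c) \<bullet> (x v - c) - (x u - c) \<bullet> (x u - c)\<bar> \<le> 2 * B * norm (x v - x u)"
    proof -
      have "(x v - c) \<bullet> (x v - c) - (x u - c) \<bullet> (x u - c) = (x v - x u) \<bullet> ((x v - c) + (x u - c))"
        by (simp add: inner_diff inner_add inner_commute algebra_simps)
      also have "\<bar>\<dots>\<bar> \<le> norm (x v - x u) * norm ((x v - c) + (x u - c))"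
        by (rule Cauchy_Schwarz_ineq2)
      also have "\<dots> \<le> norm (x v - x u) * (2 * B)"
        using B[of u] B[of v] uv norm_triangle_ineq[of "x v - c" "x u - c"]
        by (intro mult_left_mono) auto
      finally show ?thesis by (simp add: mult_ac)
    qed
    have sq_v: "(x v - c) \<bullet> (x v - c) \<le> B\<^sup>2"
      using B[of v] uv unfolding power2_norm_eq_inner[symmetric] by (intro power_mono) auto
    have "f v - f u = (exp (\<alpha> * v) - exp (\<alpha> * u)) * ((x v - c) \<bullet> (x v - c))
        + exp (\<alpha> * u) * ((x v - c) \<bullet> (x v - c) - (x u - c) \<bullet> (x u - c))"
      by (simp add: f_def algebra_simps)
    also have "\<bar>\<dots>\<bar> \<le> \<bar>exp (\<alpha> * v) - exp (\<alpha> * u)\<bar> * ((x v - c) \<bullet> (x v - c))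
        + exp (\<alpha> * u) * \<bar>(x v - c) \<bullet> (x v - c) - (x u - c) \<bullet> (x u - c)\<bar>"
      by (rule order.trans[OF abs_triangle_ineq]) (simp add: abs_mult)
    also have "\<dots> \<le> E * \<alpha> * (v - u) * B\<^sup>2 + E * (2 * B * norm (x v - x u))"
      using exp_diff sq_diff sq_v E[of u] uv \<open>\<alpha> \<ge> 0\<close>
      by (intro add_mono mult_mono) (auto simp: E_def)
    also have "\<dots> \<le> (E * \<alpha> * B\<^sup>2 + E * 2 * B) * (norm (x v - x u) + (v - u))"
    proof -
      have "E * \<alpha> * B\<^sup>2 * (v - u) \<le> E * \<alpha> * B\<^sup>2 * (norm (x v - x u) + (v - u))"
        "E * 2 * B * norm (x v - x u) \<le> E * 2 * B * (norm (x v - x u) + (v - u))"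
        using uv \<open>\<alpha> \<ge> 0\<close> \<open>B > 0\<close> by (auto intro!: mult_left_mono simp: E_def)
      then show ?thesis
        by (simp add: algebra_simps)
    qed
    finally show "norm (f v - f u) \<le> (E * \<alpha> * B\<^sup>2 + E * 2 * B) * (norm (x v - x u) + (v - u))"
      by simp
  qed
  moreover
  have "AE s in lebesgue_on {0..}. (x has_vector_derivative F (x s)) (at s within {0..})"
    using x by (simp add: strong_global_solution_def)
  then have "AE s in lebesgue. s \<in> {0..} \<longrightarrow> (x has_vector_derivative F (x s)) (at s within {0..})"
    by (simp add: AE_restrict_space_iff)
  then obtain N where N: "N \<in> null_sets lebesgue"
    and xder: "\<And>s. s \<ge> 0 \<Longrightarrow> s \<notin> N \<Longrightarrow> (x has_vector_derivative F (x s)) (at s within {0..})"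
    by (auto elim!: AE_E3)
  have "\<exists>D\<le>0. (f has_real_derivative D) (at s within {0..t})" if s: "s \<in> {0..t} - N" for s
  proof (intro exI conjI)
    let ?D = "exp (\<alpha> * s) * (\<alpha> * ((x s - c) \<bullet> (x s - c)) + 2 * ((x s - c) \<bullet> F (x s)))"
    have "(x has_vector_derivative F (x s)) (at s within {0..t})"
      using xder[of s] s by (auto intro: has_vector_derivative_within_subset)
    then have "(x has_derivative (\<lambda>h. h *\<^sub>R F (x s))) (at s within {0..t})"
      by (simp add: has_vector_derivative_def)
    then have "(f has_derivative (*) ?D) (at s within {0..t})"
      unfolding f_def
      by (auto intro!: derivative_eq_intros simp: inner_commute algebra_simps fun_eq_iff)
    then show "(f has_real_derivative ?D) (at s within {0..t})"
      by (simp add: has_field_derivative_def)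
    have "\<alpha> * ((x s - c) \<bullet> (x s - c)) + 2 * ((x s - c) \<bullet> F (x s)) \<le> 0"
      using diss[of "x s"] by (simp add: power2_norm_eq_inner)
    then show "?D \<le> 0"
      by (simp add: mult_nonneg_nonpos)
  qed
  ultimately have "f t \<le> f 0"
    using abs_continuous_on_AE_deriv_nonpos[OF \<open>t \<ge> 0\<close>] N by blast
  then have "exp (- \<alpha> * t) * f t \<le> exp (- \<alpha> * t) * f 0"
    by (intro mult_left_mono) auto
  then show ?thesis
    by (simp add: f_def power2_norm_eq_inner mult_ac flip: exp_add mult.assoc)
qed simp

section \<open>Proper lower semicontinuous convex functions\<close>

text \<open>Lets \<open>s\<close> tend to 0 from the right. It closes the arguments that test an
  inequality along a short segment and divide by its parameter.\<close>

lemma le_if_le_add_scaled: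
  fixes a b c :: real
  assumes "\<And>s. 0 < s \<Longrightarrow> s \<le> 1 \<Longrightarrow> a \<le> b + s * c"
  shows "a \<le> b"
proof (rule tendsto_lowerbound)
  show "((\<lambda>s. b + s * c) \<longlongrightarrow> b) (at_right 0)"
    by (auto intro!: tendsto_eq_intros)
  show "\<forall>\<^sub>F s in at_right 0. a \<le> b + s * c"
    using eventually_at_right_real[of 0 "1::real"] by (auto elim!: eventually_mono intro: assms)
qed simp

text \<open>Turns coercivity estimates into norm bounds; completing the square at
  \<open>B + 1/2\<close> avoids roots and sign conditions on \<open>A\<close> and
  \<open>B\<close>.\<close>

lemma le_if_quadratic_le:
  fixes A B s :: real
  assumes "s\<^sup>2 \<le> A + 2 * B * s"
  shows "s \<le> A + B\<^sup>2 + B + 1"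
proof -
  have "0 \<le> (s - B - 1/2)\<^sup>2" by simp
  then show ?thesis
    using assms by (simp add: power2_eq_square algebra_simps)
qed

lemma norm_scaled_diff_power2:
  fixes x y :: "'a::real_inner"
  shows "(norm (x - s *\<^sub>R y))\<^sup>2 = (norm x)\<^sup>2 - 2 * s * (x \<bullet> y) + s\<^sup>2 * (norm y)\<^sup>2"
  unfolding power2_norm_eq_inner
  by (simp add: inner_diff inner_commute[of y x] power2_eq_square algebra_simps)

lemma norm_power2_convex:
  fixes x y :: "'a::real_inner"
  assumes "0 \<le> a" "a \<le> 1"
  shows "(norm (a *\<^sub>R x + (1 - a) *\<^sub>R y))\<^sup>2 \<le> a * (norm x)\<^sup>2 + (1 - a) * (norm y)\<^sup>2"
proof -
  have "a * (norm x)\<^sup>2 + (1 - a) * (norm y)\<^sup>2 - (norm (a *\<^sub>R x + (1 - a) *\<^sub>R y))\<^sup>2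
      = a * (1 - a) * (norm (x - y))\<^sup>2"
    unfolding power2_norm_eq_inner
    by (simp add: inner_diff inner_add inner_commute[of y x] algebra_simps)
  also have "\<dots> \<ge> 0" using assms by simp
  finally show ?thesis by simp
qed

locale proper_lsc_convex =
  fixes C :: "'a::{real_inner, complete_space} set" and h :: "'a \<Rightarrow> ereal"
  assumes closed_C: "closed C"
    and proper: "proper_on C h" and lsc: "lower_semicont_on C h" and conv: "ereal_convex_on C h"
begin

abbreviation "D \<equiv> eff_dom C h"

text \<open>Allows real arithmetic on \<open>D\<close>, where \<open>h\<close> is finite. At points
  of \<open>C\<close> outside \<open>D\<close> the conversion sends infinity to 0, so
  \<open>g\<close> represents \<open>h\<close> only on \<open>D\<close>.\<close>

definition g :: "'a \<Rightarrow> real" where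
  "g v = real_of_ereal (h v)"

lemma h_eq: "v \<in> D \<Longrightarrow> h v = ereal (g v)"
  using proper unfolding proper_on_def eff_dom_def g_def
  by (cases "h v") auto

lemma D_subset: "D \<subseteq> C"
  by (auto simp: eff_dom_def)

lemma h_infinite: "v \<in> C - D \<Longrightarrow> h v = \<infinity>"
  by (auto simp: eff_dom_def)

lemma D_nonempty: "D \<noteq> {}"
  using proper by (simp add: proper_on_def)

lemma convex_D: "convex D"
  using conv by (simp add: ereal_convex_on_def)

lemma convex_comb_in_D: "u \<in> D \<Longrightarrow> v \<in> D \<Longrightarrow> 0 \<le> a \<Longrightarrow> a \<le> 1 \<Longrightarrow> a *\<^sub>R u + (1 - a) *\<^sub>R v \<in> D"
  using convex_D unfolding convex_def by auto

lemma g_convex: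
  assumes "u \<in> D" "v \<in> D" "0 \<le> a" "a \<le> 1"
  shows "g (a *\<^sub>R u + (1 - a) *\<^sub>R v) \<le> a * g u + (1 - a) * g v"
proof -
  have "h (a *\<^sub>R u + (1 - a) *\<^sub>R v) \<le> ereal a * h u + ereal (1 - a) * h v"
    using conv assms by (auto simp: ereal_convex_on_def)
  then show ?thesis
    using assms convex_comb_in_D[OF assms] by (simp add: h_eq)
qed

text \<open>The \<open>Liminf\<close> concerns only points other than \<open>l\<close>; the strict
  inequality assumed at \<open>l\<close> fills in the centre.\<close>

lemma eventually_gt_h:
  assumes "l \<in> C" "ereal r < h l"
  shows "\<forall>\<^sub>F v in nhds l. v \<in> C \<longrightarrow> ereal r < h v"
proof -
  have "h l \<le> Liminf (at l within C) h"
    using lsc assms(1) by (auto simp: lower_semicont_on_def)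
  then have "\<forall>\<^sub>F v in at l within C. ereal r < h v"
    using assms(2) le_Liminf_iff by blast
  then show ?thesis
    unfolding eventually_at_filter
    by eventually_elim (use assms(2) in auto)
qed

text \<open>If \<open>h l\<close> exceeded \<open>k l\<close>, a real \<open>r\<close> strictly
  between them would eventually separate \<open>h (v n)\<close> from \<open>k (v n)\<close>. The
  resulting finite bound on \<open>h l\<close> also puts the limit back in \<open>D\<close>. A
  variable threshold \<open>k\<close> covers both proximal sublevel sets and Minty sets.\<close>

lemma closed_sublevel:
  assumes k: "continuous_on UNIV k"
  shows "closed {v \<in> D. g v \<le> k v}"
  unfolding closed_sequential_limits
proof (intro allI impI)
  fix v l assume *: "(\<forall>n. v n \<in> {v \<in> D. g v \<le> k v}) \<and> v \<longlonglongrightarrow> l"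
  then have v: "\<And>n. v n \<in> D" "\<And>n. g (v n) \<le> k (v n)" and l: "v \<longlonglongrightarrow> l"
    by auto
  have "l \<in> C"
    using closed_sequentially[OF closed_C _ l] v(1) D_subset by blast
  have "h l \<le> ereal (k l)"
  proof (rule ccontr)
    assume "\<not> h l \<le> ereal (k l)"
    then obtain r where r: "k l < r" "ereal r < h l"
      using ereal_dense2[of "ereal (k l)" "h l"] by (metis less_ereal.simps(1) not_le)
    have "\<forall>\<^sub>F n in sequentially. v n \<in> C \<longrightarrow> ereal r < h (v n)"
      using eventually_compose_filterlim[OF eventually_gt_h[OF \<open>l \<in> C\<close> r(2)] l] .
    moreover have "(\<lambda>n. k (v n)) \<longlonglongrightarrow> k l"
      using k l by (auto intro: continuous_on_tendsto_compose)
    then have "\<forall>\<^sub>F n in sequentially. k (v n) < r"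
      using r(1) by (simp add: order_tendsto_iff)
    ultimately have "\<forall>\<^sub>F n in sequentially. False"
    proof eventually_elim
      case (elim n)
      then have "r < g (v n)"
        using v(1)[of n] D_subset h_eq[of "v n"] by auto
      then show False
        using v(2)[of n] elim(2) by linarith
    qed
    then show False by simp
  qed
  moreover from this have "l \<in> D"
    using \<open>l \<in> C\<close> by (auto simp: eff_dom_def)
  ultimately show "l \<in> {v \<in> D. g v \<le> k v}"
    using h_eq by simp
qed

text \<open>
  Near \<open>v0\<close> lower semicontinuity bounds \<open>g\<close> from below; convexity along rays from \<open>v0\<close>
  propagates this bound, avoiding Hahn--Banach.
\<close>

lemma g_minorant:
  assumes "v0 \<in> D"
  obtains K where "K \<ge> 0" "\<And>v. v \<in> D \<Longrightarrow> g v \<ge> g v0 - 1 - K * norm (v - v0)"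
proof -
  have "\<forall>\<^sub>F v in nhds v0. v \<in> C \<longrightarrow> ereal (g v0 - 1) < h v"
    using assms D_subset by (intro eventually_gt_h) (auto simp: h_eq)
  then obtain d where "d > 0" and d: "\<And>v. dist v v0 < d \<Longrightarrow> v \<in> C \<Longrightarrow> ereal (g v0 - 1) < h v"
    unfolding eventually_nhds_metric by blast
  have near: "g v0 - 1 < g v" if "v \<in> D" "norm (v - v0) < d" for v
    using d[of v] that D_subset by (auto simp: h_eq dist_norm)
  have "g v \<ge> g v0 - 1 - (2 / d) * norm (v - v0)" if v: "v \<in> D" for v
  proof (cases "norm (v - v0) < d")
    case True
    then show ?thesis
      using near[OF v] \<open>d > 0\<close> by (smt (verit) divide_nonneg_pos mult_nonneg_nonneg norm_ge_zero)
  next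
    case False
    then have "norm (v - v0) > 0" using \<open>d > 0\<close> by linarith
    \<comment> \<open>This parameter places \<open>?w\<close> on the segment from \<open>v0\<close>
      to \<open>v\<close> at distance \<open>d / 2\<close> from \<open>v0\<close>, inside the ball
      where \<open>near\<close> applies.\<close>
    define s where "s = d / (2 * norm (v - v0))"
    have s: "0 < s" "s \<le> 1" and inv_s: "1 / s = 2 / d * norm (v - v0)"
      using False \<open>d > 0\<close> \<open>norm (v - v0) > 0\<close> by (auto simp: s_def field_simps)
    let ?w = "s *\<^sub>R v + (1 - s) *\<^sub>R v0"
    have "?w - v0 = s *\<^sub>R (v - v0)"
      by (simp add: algebra_simps)
    then have "norm (?w - v0) < d"
      using False \<open>d > 0\<close> by (simp add: s_def)
    then have "g v0 - 1 < g ?w"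
      using v assms s by (intro near convex_comb_in_D) auto
    also have "\<dots> \<le> s * g v + (1 - s) * g v0"
      using v assms s by (intro g_convex) auto
    finally have "s * (g v0 - g v) < 1"
      by (simp add: algebra_simps)
    then have "g v0 - g v < 1 / s"
      using s by (simp add: field_simps)
    then show ?thesis
      unfolding inv_s by simp
  qed
  then show thesis
    using that[of "2 / d"] \<open>d > 0\<close> by simp
qed

section \<open>Proximal points: variational characterisation, uniqueness and existence\<close>

definition prox_obj :: "real \<Rightarrow> 'a \<Rightarrow> 'a \<Rightarrow> real" where
  "prox_obj lam u v = lam * g v + 1/2 * (norm (u - v))\<^sup>2"

text \<open>The first-order optimality condition for minimising \<open>prox_obj lam u\<close> over
  \<open>D\<close>; later estimates use this form in place of the minimum.\<close>

definition is_prox :: "real \<Rightarrow> 'a \<Rightarrow> 'a \<Rightarrow> bool" where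
  "is_prox lam u p \<longleftrightarrow> p \<in> D \<and> (\<forall>v\<in>D. (u - p) \<bullet> (v - p) \<le> lam * (g v - g p))"

text \<open>Testing each inequality with the other point and adding cancels \<open>g\<close> and
  leaves the squared distance.\<close>

lemma is_prox_unique:
  assumes "is_prox lam u p" "is_prox lam u q"
  shows "p = q"
proof -
  have "(u - p) \<bullet> (q - p) \<le> lam * (g q - g p)" "(u - q) \<bullet> (p - q) \<le> lam * (g p - g q)"
    using assms by (auto simp: is_prox_def)
  then have "(u - p) \<bullet> (q - p) + (u - q) \<bullet> (p - q) \<le> 0"
    by (simp add: algebra_simps)
  moreover have "(u - p) \<bullet> (q - p) + (u - q) \<bullet> (p - q) = (norm (q - p))\<^sup>2"
    unfolding power2_norm_eq_inner by (simp add: inner_diff inner_commute algebra_simps)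
  ultimately show ?thesis by simp
qed

text \<open>Compare \<open>p\<close> with a point at parameter \<open>s\<close> on the segment
  towards \<open>v\<close>, divide by \<open>s\<close>, and let \<open>s\<close> tend to 0; the
  quadratic remainder vanishes.\<close>

lemma prox_obj_minimizer_imp_is_prox:
  assumes "p \<in> D" and min: "\<And>v. v \<in> D \<Longrightarrow> prox_obj lam u p \<le> prox_obj lam u v" and "lam > 0"
  shows "is_prox lam u p"
  unfolding is_prox_def
proof (intro conjI ballI \<open>p \<in> D\<close>)
  fix v assume v: "v \<in> D"
  show "(u - p) \<bullet> (v - p) \<le> lam * (g v - g p)"
  proof (rule le_if_le_add_scaled[where c = "1/2 * (norm (v - p))\<^sup>2"])
    fix s :: real assume s: "0 < s" "s \<le> 1"
    let ?w = "s *\<^sub>R v + (1 - s) *\<^sub>R p"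
    have "u - ?w = (u - p) - s *\<^sub>R (v - p)"
      by (simp add: algebra_simps)
    then have nw: "(norm (u - ?w))\<^sup>2 = (norm (u - p))\<^sup>2 - 2 * s * ((u - p) \<bullet> (v - p)) + s\<^sup>2 * (norm (v - p))\<^sup>2"
      by (simp only: norm_scaled_diff_power2)
    have "prox_obj lam u p \<le> prox_obj lam u ?w"
      using v \<open>p \<in> D\<close> s by (intro min convex_comb_in_D) auto
    moreover have "lam * g ?w \<le> lam * (s * g v + (1 - s) * g p)"
      using v \<open>p \<in> D\<close> s \<open>lam > 0\<close> by (intro mult_left_mono g_convex) auto
    ultimately have "s * ((u - p) \<bullet> (v - p)) \<le> s * (lam * (g v - g p) + s * (1/2 * (norm (v - p))\<^sup>2))"
      unfolding prox_obj_def nw by (simp add: algebra_simps power2_eq_square)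
    then show "(u - p) \<bullet> (v - p) \<le> lam * (g v - g p) + s * (1/2 * (norm (v - p))\<^sup>2)"
      using s by simp
  qed
qed

lemma prox_obj_convex:
  assumes "lam > 0" "x \<in> D" "y \<in> D" "0 \<le> a" "a \<le> 1"
  shows "prox_obj lam u (a *\<^sub>R x + (1 - a) *\<^sub>R y) \<le> a * prox_obj lam u x + (1 - a) * prox_obj lam u y"
proof -
  have "u - (a *\<^sub>R x + (1 - a) *\<^sub>R y) = a *\<^sub>R (u - x) + (1 - a) *\<^sub>R (u - y)"
    by (simp add: algebra_simps)
  then have "(norm (u - (a *\<^sub>R x + (1 - a) *\<^sub>R y)))\<^sup>2 \<le> a * (norm (u - x))\<^sup>2 + (1 - a) * (norm (u - y))\<^sup>2"
    using norm_power2_convex[OF assms(4,5)] by metis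
  moreover have "lam * g (a *\<^sub>R x + (1 - a) *\<^sub>R y) \<le> lam * (a * g x + (1 - a) * g y)"
    using assms by (intro mult_left_mono g_convex) auto
  ultimately have "prox_obj lam u (a *\<^sub>R x + (1 - a) *\<^sub>R y)
      \<le> lam * (a * g x + (1 - a) * g y) + 1/2 * (a * (norm (u - x))\<^sup>2 + (1 - a) * (norm (u - y))\<^sup>2)"
    unfolding prox_obj_def by (intro add_mono) auto
  also have "\<dots> = a * prox_obj lam u x + (1 - a) * prox_obj lam u y"
    unfolding prox_obj_def by (simp add: field_simps)
  finally show ?thesis .
qed

text \<open>\<open>g_minorant\<close> lets \<open>g\<close> decrease at most linearly, so the
  quadratic term dominates.\<close>

lemma prox_obj_coercive:
  assumes "lam > 0"
  obtains A B where "\<And>v. v \<in> D \<Longrightarrow> (norm (u - v))\<^sup>2 \<le> A + 2 * prox_obj lam u v + 2 * B * norm (u - v)"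
proof -
  obtain v0 where v0: "v0 \<in> D" using D_nonempty by blast
  obtain K where K: "K \<ge> 0" "\<And>v. v \<in> D \<Longrightarrow> g v \<ge> g v0 - 1 - K * norm (v - v0)"
    using g_minorant[OF v0] by blast
  have "(norm (u - v))\<^sup>2 \<le> (- 2 * lam * (g v0 - 1 - K * norm (u - v0))) + 2 * prox_obj lam u v
      + 2 * (lam * K) * norm (u - v)" if "v \<in> D" for v
  proof -
    have "norm (v - v0) \<le> norm (u - v) + norm (u - v0)"
      using norm_triangle_ineq4[of "u - v0" "u - v"] by (simp add: add.commute)
    then have "K * norm (v - v0) \<le> K * (norm (u - v) + norm (u - v0))"
      using K(1) by (rule mult_left_mono)
    then have "g v \<ge> g v0 - 1 - K * (norm (u - v) + norm (u - v0))"
      using K(2)[OF that] by linarith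
    then have "lam * g v \<ge> lam * (g v0 - 1 - K * (norm (u - v) + norm (u - v0)))"
      using assms by (intro mult_left_mono) auto
    then show ?thesis
      unfolding prox_obj_def by (simp add: algebra_simps)
  qed
  then show thesis using that by blast
qed

text \<open>The nearly optimal sets \<open>S e\<close> are nested, closed and convex, and
  \<open>S 1\<close> is bounded by coercivity, so they share a point, which attains the
  infimum.\<close>

lemma ex_prox_obj_minimizer:
  assumes "lam > 0"
  obtains p where "p \<in> D" "\<And>v. v \<in> D \<Longrightarrow> prox_obj lam u p \<le> prox_obj lam u v"
proof -
  obtain A B where coer: "\<And>v. v \<in> D \<Longrightarrow> (norm (u - v))\<^sup>2 \<le> A + 2 * prox_obj lam u v + 2 * B * norm (u - v)"
    using prox_obj_coercive[OF assms] by blast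
  have lower: "- (A + B\<^sup>2) / 2 \<le> prox_obj lam u v" if "v \<in> D" for v
  proof -
    have "0 \<le> (norm (u - v) - B)\<^sup>2" by simp
    then show ?thesis
      using coer[OF that] unfolding power2_diff by (simp add: mult_ac)
  qed
  define m where "m = (INF v\<in>D. prox_obj lam u v)"
  have m_le: "m \<le> prox_obj lam u v" if "v \<in> D" for v
    unfolding m_def using bdd_belowI2[of D _ "prox_obj lam u", OF lower] that by (rule cINF_lower)
  define S where "S e = {v \<in> D. prox_obj lam u v \<le> m + e}" for e
  have S_ne: "S e \<noteq> {}" if "e > 0" for e
    using cINF_less_iff[OF D_nonempty bdd_belowI2[of D _ "prox_obj lam u", OF lower], folded m_def, of "m + e"] that
    by (force simp: S_def)
  have "\<Inter>(S ` {0<..}) \<noteq> {}"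
  proof (rule hilbert_closed_convex_fip)
    show "closed X" if X: "X \<in> S ` {0<..}" for X
    proof -
      obtain e where "X = S e" using X by blast
      also have "S e = {v \<in> D. g v \<le> (m + e - 1/2 * (norm (u - v))\<^sup>2) / lam}"
        using assms by (auto simp: S_def prox_obj_def field_simps)
      finally show ?thesis
        by (simp only:) (intro closed_sublevel continuous_intros, use assms in auto)
    qed
    show "convex X" if X: "X \<in> S ` {0<..}" for X
    proof -
      obtain e where e: "X = S e" using X by blast
      have "s *\<^sub>R x + (1 - s) *\<^sub>R y \<in> S e" if "x \<in> S e" "y \<in> S e" "0 \<le> s" "s \<le> 1" for x y s
      proof -
        have "prox_obj lam u (s *\<^sub>R x + (1 - s) *\<^sub>R y) \<le> s * prox_obj lam u x + (1 - s) * prox_obj lam u y"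
          using that assms by (intro prox_obj_convex) (auto simp: S_def)
        also have "\<dots> \<le> m + e"
          using that by (intro convex_bound_le) (auto simp: S_def)
        finally show ?thesis
          using that convex_comb_in_D by (auto simp: S_def)
      qed
      then show ?thesis
        unfolding e convex_alt by (metis add.commute)
    qed
    show "S 1 \<in> S ` {0<..}" by simp
    show "bounded (S 1)"
    proof (rule bounded_subset[OF bounded_cball])
      show "S 1 \<subseteq> cball u (A + 2 * (m + 1) + B\<^sup>2 + B + 1)"
      proof
        fix v assume v: "v \<in> S 1"
        have "(norm (u - v))\<^sup>2 \<le> (A + 2 * (m + 1)) + 2 * B * norm (u - v)"
          using coer[of v] v by (simp add: S_def)
        from le_if_quadratic_le[OF this] show "v \<in> cball u (A + 2 * (m + 1) + B\<^sup>2 + B + 1)"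
          by (simp add: dist_norm)
      qed
    qed
    show "\<Inter>F \<noteq> {}" if F: "finite F" "F \<subseteq> S ` {0<..}" for F
    proof -
      obtain E where E: "E \<subseteq> {0<..}" "finite E" "F = S ` E"
        using finite_subset_image[OF F] by blast
      show ?thesis
      proof (cases "E = {}")
        case False
        then have "Min E > 0" using E by auto
        moreover have "S (Min E) \<subseteq> S e" if "e \<in> E" for e
          using Min_le[OF E(2) that] by (auto simp: S_def)
        ultimately show ?thesis
          using S_ne[of "Min E"] unfolding E(3) by blast
      qed (use E in simp)
    qed
  qed
  then obtain p where p: "\<And>e. e > 0 \<Longrightarrow> p \<in> S e" by blast
  then have "p \<in> D" using p[of 1] by (simp add: S_def)
  moreover have "prox_obj lam u p \<le> m"
    by (rule field_le_epsilon) (use p in \<open>auto simp: S_def\<close>)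
  ultimately show thesis
    using that m_le by (meson order.trans)
qed

text \<open>\<open>prox\<close> is a choice operator, so a minimiser must exist before anything is
  known about its value. Comparison with the finite value at \<open>q\<close> then forces the chosen
  point into \<open>D\<close>.\<close>

lemma is_prox_prox:
  assumes "lam > 0"
  shows "is_prox lam u (prox C lam h u)"
proof -
  define \<phi> where "\<phi> = (\<lambda>v. ereal lam * h v + ereal (1/2 * (norm (u - v))\<^sup>2))"
  have \<phi>_D: "\<phi> v = ereal (prox_obj lam u v)" if "v \<in> D" for v
    using that by (simp add: h_eq prox_obj_def \<phi>_def)
  have \<phi>_C: "\<phi> v = \<infinity>" if "v \<in> C - D" for v
    using h_infinite[OF that] assms by (simp add: \<phi>_def)
  obtain q where q: "q \<in> D" "\<And>v. v \<in> D \<Longrightarrow> prox_obj lam u q \<le> prox_obj lam u v"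
    using ex_prox_obj_minimizer[OF assms] by blast
  have "is_arg_min \<phi> (\<lambda>v. v \<in> C) q"
    unfolding is_arg_min_def
  proof (intro conjI notI)
    show "q \<in> C" using q(1) D_subset by blast
    assume "\<exists>v. v \<in> C \<and> \<phi> v < \<phi> q"
    then obtain v where v: "v \<in> C" "\<phi> v < \<phi> q" by blast
    show False
    proof (cases "v \<in> D")
      case True
      then show ?thesis using v(2) q(2)[OF True] \<phi>_D[OF True] \<phi>_D[OF q(1)] by simp
    next
      case False
      then have "\<phi> v = \<infinity>" using v(1) \<phi>_C[of v] by simp
      then show ?thesis using v(2) by (metis ereal_less_eq(1) not_less)
    qed
  qed
  then have "is_arg_min \<phi> (\<lambda>v. v \<in> C) (prox C lam h u)"
    unfolding prox_def arg_min_on_def arg_min_def \<phi>_def[symmetric]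
    by (rule someI[of "is_arg_min \<phi> (\<lambda>v. v \<in> C)"])
  then have p: "prox C lam h u \<in> C" "\<And>v. v \<in> C \<Longrightarrow> \<phi> (prox C lam h u) \<le> \<phi> v"
    by (auto simp: is_arg_min_def not_less)
  have "\<phi> (prox C lam h u) \<le> ereal (prox_obj lam u q)"
    using p(2)[of q] q(1) D_subset \<phi>_D[OF q(1)] by auto
  then have pD: "prox C lam h u \<in> D"
    using \<phi>_C[of "prox C lam h u"] p(1) by (cases "prox C lam h u \<in> D") auto
  show ?thesis
  proof (rule prox_obj_minimizer_imp_is_prox[OF pD _ assms])
    fix v assume "v \<in> D"
    then show "prox_obj lam u (prox C lam h u) \<le> prox_obj lam u v"
      using p(2)[of v] D_subset \<phi>_D[of v] \<phi>_D[OF pD] by auto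
  qed
qed

lemma prox_eq_iff: "lam > 0 \<Longrightarrow> prox C lam h u = p \<longleftrightarrow> is_prox lam u p"
  using is_prox_prox[of lam u] is_prox_unique by metis

lemma mvi_solution_iff:
  "mvi_solution C h T c \<longleftrightarrow> c \<in> D \<and> (\<forall>u\<in>D. 0 \<le> T c \<bullet> (u - c) + g u - g c)"
proof (cases "c \<in> D")
  case True
  have "0 \<le> ereal (T c \<bullet> (u - c)) + h u - h c \<longleftrightarrow> (u \<in> D \<longrightarrow> 0 \<le> T c \<bullet> (u - c) + g u - g c)"
    if "u \<in> C" for u
    using that True h_infinite[of u] by (cases "u \<in> D") (auto simp: h_eq)
  then show ?thesis
    using True D_subset by (auto simp: mvi_solution_def)
qed (simp add: mvi_solution_def)

end

section \<open>The mixed variational inequality and the dynamical system\<close>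

locale strongly_pseudomonotone_mvi = proper_lsc_convex C h
  for C :: "'a::{real_inner, complete_space} set" and h :: "'a \<Rightarrow> ereal" +
  fixes T :: "'a \<Rightarrow> 'a" and mu \<beta> :: real
  assumes mu_pos: "mu > 0" and pseudomonotone: "strongly_pseudomonotone_wrt C h T mu"
    and lipschitz: "lipschitz_on \<beta> UNIV T"
begin

lemma T_lipschitz: "norm (T x - T y) \<le> \<beta> * norm (x - y)"
  using lipschitz_onD[OF lipschitz, of x y] by (simp add: dist_norm)

lemma beta_nonneg: "\<beta> \<ge> 0"
  using lipschitz by (rule lipschitz_on_nonneg)

lemma pseudomonotoneD:
  assumes "u \<in> D" "v \<in> D" "0 \<le> T u \<bullet> (v - u) + g v - g u"
  shows "mu * (norm (u - v))\<^sup>2 \<le> T v \<bullet> (v - u) + g v - g u"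
proof -
  have "v \<in> C" using assms(2) D_subset by blast
  have "ereal (T u \<bullet> (v - u)) + h v - h u \<ge> 0"
    using assms by (simp add: h_eq)
  then have "ereal (T v \<bullet> (v - u)) + h v - h u \<ge> ereal (mu * (norm (u - v))\<^sup>2)"
    using pseudomonotone \<open>u \<in> D\<close> \<open>v \<in> C\<close> unfolding strongly_pseudomonotone_wrt_def by blast
  then show ?thesis
    using assms by (simp add: h_eq)
qed

section \<open>Uniqueness and existence for the mixed variational inequality\<close>

lemma mvi_solution_unique:
  assumes "mvi_solution C h T c" "mvi_solution C h T d"
  shows "c = d"
proof -
  have cd: "c \<in> D" "d \<in> D" "0 \<le> T c \<bullet> (d - c) + g d - g c" "0 \<le> T d \<bullet> (c - d) + g c - g d"
    using assms by (auto simp: mvi_solution_iff)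
  have "mu * (norm (c - d))\<^sup>2 \<le> T d \<bullet> (d - c) + g d - g c"
    using cd by (intro pseudomonotoneD)
  also have "\<dots> \<le> 0"
    using cd(4) by (simp add: inner_diff_right)
  finally show ?thesis
    using mu_pos by (simp add: mult_le_0_iff)
qed

text \<open>Evaluating \<open>T\<close> at the test point \<open>v\<close> makes the condition on
  \<open>c\<close> closed and convex. The quadratic term records strong pseudomonotonicity and
  yields boundedness.\<close>

definition minty_set :: "'a \<Rightarrow> 'a set" where
  "minty_set v = {c \<in> D. T v \<bullet> (c - v) + g c - g v + mu * (norm (c - v))\<^sup>2 \<le> 0}"

lemma closed_minty_set: "closed (minty_set v)"
proof -
  have "minty_set v = {c \<in> D. g c \<le> g v - T v \<bullet> (c - v) - mu * (norm (c - v))\<^sup>2}"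
    by (auto simp: minty_set_def algebra_simps)
  then show ?thesis
    by (simp only:) (intro closed_sublevel continuous_intros)
qed

lemma convex_minty_set:
  assumes "v \<in> D"
  shows "convex (minty_set v)"
  unfolding convex_alt
proof (intro ballI allI impI)
  fix x y and s :: real
  assume x: "x \<in> minty_set v" and y: "y \<in> minty_set v" and s: "0 \<le> s \<and> s \<le> 1"
  have D: "x \<in> D" "y \<in> D" using x y by (auto simp: minty_set_def)
  let ?w = "s *\<^sub>R y + (1 - s) *\<^sub>R x"
  let ?f = "\<lambda>c. T v \<bullet> (c - v) + g c - g v + mu * (norm (c - v))\<^sup>2"
  have w: "?w - v = s *\<^sub>R (y - v) + (1 - s) *\<^sub>R (x - v)"
    by (simp add: algebra_simps)
  have "T v \<bullet> (?w - v) = s * (T v \<bullet> (y - v)) + (1 - s) * (T v \<bullet> (x - v))"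
    unfolding w by (simp add: inner_add_right)
  moreover have "g ?w \<le> s * g y + (1 - s) * g x"
    using D s by (intro g_convex) auto
  moreover have "mu * (norm (?w - v))\<^sup>2 \<le> mu * (s * (norm (y - v))\<^sup>2 + (1 - s) * (norm (x - v))\<^sup>2)"
    unfolding w using s mu_pos by (intro mult_left_mono norm_power2_convex) auto
  ultimately have "?f ?w \<le> s * (T v \<bullet> (y - v)) + (1 - s) * (T v \<bullet> (x - v)) + (s * g y + (1 - s) * g x) - g v
      + mu * (s * (norm (y - v))\<^sup>2 + (1 - s) * (norm (x - v))\<^sup>2)"
    by linarith
  also have "\<dots> = s * ?f y + (1 - s) * ?f x"
    by (simp add: algebra_simps)
  also have "\<dots> \<le> 0"
    using x y s by (intro convex_bound_le) (auto simp: minty_set_def)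
  finally show "(1 - s) *\<^sub>R x + s *\<^sub>R y \<in> minty_set v"
    using D s convex_comb_in_D[of y x s] by (simp add: minty_set_def add.commute)
qed

lemma bounded_minty_set:
  assumes "v \<in> D"
  shows "bounded (minty_set v)"
proof -
  obtain K where K: "K \<ge> 0" "\<And>c. c \<in> D \<Longrightarrow> g c \<ge> g v - 1 - K * norm (c - v)"
    using g_minorant[OF assms] by blast
  define B where "B = (K + norm (T v)) / 2"
  have "mu * norm (c - v) \<le> mu + B\<^sup>2 + B + 1" if c: "c \<in> minty_set v" for c
  proof (rule le_if_quadratic_le)
    have "- (T v \<bullet> (c - v)) \<le> norm (T v) * norm (c - v)"
      using Cauchy_Schwarz_ineq2[of "T v" "c - v"] by linarith
    moreover have "2 * B * norm (c - v) = K * norm (c - v) + norm (T v) * norm (c - v)"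
      by (simp add: B_def distrib_right)
    moreover have "c \<in> D" "T v \<bullet> (c - v) + g c - g v + mu * (norm (c - v))\<^sup>2 \<le> 0"
      using c by (auto simp: minty_set_def)
    ultimately have "mu * (norm (c - v))\<^sup>2 \<le> 1 + 2 * B * norm (c - v)"
      using K(2)[of c] by linarith
    \<comment> \<open>Multiplying by \<open>mu\<close> produces a quadratic inequality with leading
      coefficient 1 in \<open>mu * norm (c - v)\<close>.\<close>
    then have "mu * (mu * (norm (c - v))\<^sup>2) \<le> mu * (1 + 2 * B * norm (c - v))"
      using mu_pos by (intro mult_left_mono) auto
    then show "(mu * norm (c - v))\<^sup>2 \<le> mu + 2 * B * (mu * norm (c - v))"
      by (simp add: power2_eq_square algebra_simps)
  qed
  then have "minty_set v \<subseteq> cball v ((mu + B\<^sup>2 + B + 1) / mu)"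
    using mu_pos by (auto simp: dist_norm norm_minus_commute field_simps)
  then show ?thesis
    using bounded_subset[OF bounded_cball] by blast
qed

text \<open>
  The sets \<^const>\<open>minty_set\<close> form a KKM family: if \<open>c\<close> lay in the convex hull of \<open>A\<close> but in
  no \<open>minty_set a\<close>, pseudomonotonicity would give \<open>T c \<bullet> (a - c) + g a - g c < 0\<close> for all
  \<open>a \<in> A\<close>, hence by convexity of \<open>g\<close> also for \<open>a = c\<close>.
\<close>

lemma finite_Inter_minty_set:
  assumes "finite V" "V \<subseteq> D" "V \<noteq> {}"
  shows "(\<Inter>v\<in>V. minty_set v) \<noteq> {}"
proof -
  have "\<exists>c\<in>convex hull V. \<forall>v\<in>V. c \<in> minty_set v"
  proof (rule convex_KKM[OF assms(1,3)])
    show "convex hull A \<subseteq> (\<Union>a\<in>A. minty_set a)" if "A \<subseteq> V" for A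
    proof
      fix c assume c: "c \<in> convex hull A"
      have "A \<subseteq> D" using that assms(2) by blast
      then have "c \<in> D"
        using c hull_minimal[of A D convex] convex_D by blast
      show "c \<in> (\<Union>a\<in>A. minty_set a)"
      proof (rule ccontr)
        assume no: "c \<notin> (\<Union>a\<in>A. minty_set a)"
        let ?H = "{w \<in> D. T c \<bullet> (w - c) + g w - g c < 0}"
        have "a \<in> ?H" if "a \<in> A" for a
        proof (rule ccontr)
          assume "a \<notin> ?H"
          have "a \<in> D" using that \<open>A \<subseteq> D\<close> by blast
          then have "0 \<le> T c \<bullet> (a - c) + g a - g c" using \<open>a \<notin> ?H\<close> by simp
          then have "mu * (norm (c - a))\<^sup>2 \<le> T a \<bullet> (a - c) + g a - g c"
            using \<open>c \<in> D\<close> \<open>a \<in> D\<close> by (intro pseudomonotoneD)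
          then have "c \<in> minty_set a"
            using \<open>c \<in> D\<close> by (simp add: minty_set_def inner_diff_right)
          then show False using no that by blast
        qed
        moreover have "convex ?H"
          unfolding convex_alt
        proof (intro ballI allI impI)
          fix x y and s :: real
          assume x: "x \<in> ?H" and y: "y \<in> ?H" and s: "0 \<le> s \<and> s \<le> 1"
          let ?w = "s *\<^sub>R y + (1 - s) *\<^sub>R x"
          have "?w - c = s *\<^sub>R (y - c) + (1 - s) *\<^sub>R (x - c)"
            by (simp add: algebra_simps)
          then have "T c \<bullet> (?w - c) = s * (T c \<bullet> (y - c)) + (1 - s) * (T c \<bullet> (x - c))"
            by (simp only: inner_add_right inner_scaleR_right)
          moreover have "g ?w \<le> s * g y + (1 - s) * g x"
            using x y s by (intro g_convex) auto
          moreover have "s * (T c \<bullet> (y - c) + g y) + (1 - s) * (T c \<bullet> (x - c) + g x) < g c"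
            using x y s by (intro convex_bound_lt) auto
          ultimately have "T c \<bullet> (?w - c) + g ?w - g c < 0"
            by (simp add: algebra_simps)
          then show "(1 - s) *\<^sub>R x + s *\<^sub>R y \<in> ?H"
            using x y s convex_comb_in_D[of y x s] by (simp add: add.commute)
        qed
        ultimately have "convex hull A \<subseteq> ?H"
          by (intro hull_minimal) auto
        then have "c \<in> ?H" using c by blast
        then show False by simp
      qed
    qed
  qed (use assms(2) closed_minty_set convex_minty_set in auto)
  then show ?thesis by blast
qed

text \<open>A common point \<open>c\<close> of the Minty sets satisfies the inequality with
  \<open>T\<close> taken at the test point. Testing near \<open>c\<close> along the segment towards
  \<open>u\<close> and letting \<open>s\<close> tend to 0 moves \<open>T\<close> to
  \<open>c\<close>, with an error controlled by the Lipschitz constant.\<close>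

lemma ex_mvi_solution: "\<exists>c. mvi_solution C h T c"
proof -
  obtain v0 where v0: "v0 \<in> D" using D_nonempty by blast
  have "\<Inter>(minty_set ` D) \<noteq> {}"
  proof (rule hilbert_closed_convex_fip)
    show "\<Inter>F \<noteq> {}" if F: "finite F" "F \<subseteq> minty_set ` D" for F
    proof -
      obtain V where V: "V \<subseteq> D" "finite V" "F = minty_set ` V"
        using finite_subset_image[OF F] by blast
      then show ?thesis
        using finite_Inter_minty_set[of V] by (cases "V = {}") auto
    qed
  qed (use v0 closed_minty_set convex_minty_set bounded_minty_set in auto)
  then obtain c where c: "\<And>v. v \<in> D \<Longrightarrow> c \<in> minty_set v" by blast
  then have "c \<in> D" using v0 by (auto simp: minty_set_def)
  have minty: "T v \<bullet> (c - v) + g c - g v \<le> 0" if "v \<in> D" for v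
  proof -
    have "mu * (norm (c - v))\<^sup>2 \<ge> 0" using mu_pos by simp
    then show ?thesis
      using c[OF that] unfolding minty_set_def by (smt (verit) mem_Collect_eq)
  qed
  have "g c - g u \<le> T c \<bullet> (u - c)" if u: "u \<in> D" for u
  proof (rule le_if_le_add_scaled[where c = "\<beta> * (norm (u - c))\<^sup>2"])
    fix s :: real assume s: "0 < s" "s \<le> 1"
    let ?w = "s *\<^sub>R u + (1 - s) *\<^sub>R c"
    have w: "?w - c = s *\<^sub>R (u - c)" "c - ?w = - (s *\<^sub>R (u - c))"
      by (simp_all add: algebra_simps)
    have "T ?w \<bullet> (c - ?w) + g c - g ?w \<le> 0"
      using u \<open>c \<in> D\<close> s by (intro minty convex_comb_in_D) auto
    moreover have "g ?w \<le> s * g u + (1 - s) * g c"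
      using u \<open>c \<in> D\<close> s by (intro g_convex) auto
    ultimately have "s * (g c - g u) \<le> s * (T ?w \<bullet> (u - c))"
      unfolding w by (simp add: algebra_simps)
    then have "g c - g u \<le> T ?w \<bullet> (u - c)"
      using s by simp
    also have "\<dots> = T c \<bullet> (u - c) + (T ?w - T c) \<bullet> (u - c)"
      by (simp add: inner_diff_left)
    also have "(T ?w - T c) \<bullet> (u - c) \<le> (\<beta> * norm (?w - c)) * norm (u - c)"
      using T_lipschitz by (rule order.trans[OF norm_cauchy_schwarz mult_right_mono]) auto
    also have "\<dots> = s * (\<beta> * (norm (u - c))\<^sup>2)"
      unfolding w using s by (simp add: power2_eq_square)
    finally show "g c - g u \<le> T c \<bullet> (u - c) + s * (\<beta> * (norm (u - c))\<^sup>2)"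
      by simp
  qed
  then have "mvi_solution C h T c"
    using \<open>c \<in> D\<close> by (fastforce simp: mvi_solution_iff)
  then show ?thesis ..
qed

section \<open>Equilibria and dissipation of the forward-backward-forward field\<close>

context
  fixes lam :: real
  assumes lam_pos: "lam > 0" and lam_beta: "lam * \<beta> < 1"
begin

abbreviation "F \<equiv> fbf_field C h T lam"
abbreviation "p x \<equiv> prox C lam h (x - lam *\<^sub>R T x)"

lemma F_eq: "F x = p x - x + lam *\<^sub>R (T x - T (p x))"
  by (simp add: fbf_field_def Let_def)

lemma p_is_prox: "is_prox lam (x - lam *\<^sub>R T x) (p x)"
  using is_prox_prox[OF lam_pos] .

lemma scaled_T_lipschitz: "norm (lam *\<^sub>R (T x - T y)) \<le> lam * \<beta> * norm (x - y)"
  using T_lipschitz[of x y] lam_pos by (simp add: mult.assoc)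

text \<open>When the proximal point is \<open>x\<close> itself, only
  \<open>- lam *\<^sub>R T x\<close> remains on the left of its optimality condition, which becomes
  \<open>lam\<close> times the variational inequality.\<close>

lemma p_fixed_iff_mvi_solution: "p x = x \<longleftrightarrow> mvi_solution C h T x"
proof -
  have "(x - lam *\<^sub>R T x - x) \<bullet> (v - x) \<le> lam * (g v - g x) \<longleftrightarrow> 0 \<le> T x \<bullet> (v - x) + g v - g x" for v
  proof -
    have "(x - lam *\<^sub>R T x - x) \<bullet> (v - x) \<le> lam * (g v - g x) \<longleftrightarrow>
        lam * 0 \<le> lam * (T x \<bullet> (v - x) + g v - g x)"
      by (simp add: algebra_simps)
    then show ?thesis
      using lam_pos by (simp only: mult_le_cancel_left_pos)
  qed
  then show ?thesis
    unfolding prox_eq_iff[OF lam_pos] is_prox_def mvi_solution_iff by simp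
qed

text \<open>At a zero of \<open>F\<close>, the vector \<open>x - p x\<close> equals
  \<open>lam *\<^sub>R (T x - T (p x))\<close>; since \<open>lam * \<beta> < 1\<close>, this forces
  \<open>p x = x\<close>.\<close>

lemma equilibrium_point_iff_mvi_solution: "equilibrium_point F x \<longleftrightarrow> mvi_solution C h T x"
proof
  assume "equilibrium_point F x"
  then have "x - p x = lam *\<^sub>R (T x - T (p x))"
    by (simp add: equilibrium_point_def F_eq algebra_simps)
  then have "norm (x - p x) \<le> lam * \<beta> * norm (x - p x)"
    using scaled_T_lipschitz by metis
  then have "(1 - lam * \<beta>) * norm (x - p x) \<le> 0"
    by (simp add: algebra_simps)
  then have "p x = x"
    using lam_beta by (simp add: mult_le_0_iff)
  then show "mvi_solution C h T x"
    by (simp add: p_fixed_iff_mvi_solution)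
next
  assume "mvi_solution C h T x"
  then have "p x = x"
    by (simp add: p_fixed_iff_mvi_solution)
  then show "equilibrium_point F x"
    by (simp add: equilibrium_point_def F_eq)
qed

text \<open>Add the proximal inequality tested with \<open>c\<close> to \<open>lam\<close> times
  strong pseudomonotonicity from \<open>c\<close> to \<open>p x\<close>. The values of
  \<open>g\<close> cancel and the vectors paired with \<open>p x - c\<close> combine to
  \<open>F x\<close>.\<close>

lemma inner_F_prox_le:
  assumes "mvi_solution C h T c"
  shows "(p x - c) \<bullet> F x \<le> - (lam * mu * (norm (p x - c))\<^sup>2)"
proof -
  have c: "c \<in> D" "\<And>u. u \<in> D \<Longrightarrow> 0 \<le> T c \<bullet> (u - c) + g u - g c"
    using assms by (auto simp: mvi_solution_iff)
  have y: "p x \<in> D" "(x - lam *\<^sub>R T x - p x) \<bullet> (c - p x) \<le> lam * (g c - g (p x))"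
    using p_is_prox[of x] c(1) by (auto simp: is_prox_def)
  have "mu * (norm (c - p x))\<^sup>2 \<le> T (p x) \<bullet> (p x - c) + g (p x) - g c"
    using c y by (intro pseudomonotoneD) auto
  then have "lam * (mu * (norm (c - p x))\<^sup>2) \<le> lam * (T (p x) \<bullet> (p x - c) + g (p x) - g c)"
    using lam_pos by (intro mult_left_mono) auto
  then show ?thesis
    using y(2) unfolding F_eq
    by (simp add: norm_minus_commute inner_diff inner_add inner_commute algebra_simps)
qed

text \<open>Cauchy-Schwarz in \<open>inner_F_prox_le\<close> bounds \<open>p x - c\<close> by
  \<open>F x\<close>, which the Lipschitz estimate bounds by
  \<open>(1 + lam * \<beta>) * norm (x - p x)\<close>; the triangle inequality then contributes the
  term with \<open>mu\<close>.\<close>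

lemma error_bound:
  assumes "mvi_solution C h T c"
  shows "lam * mu * norm (x - c) \<le> (1 + lam * (mu + \<beta>)) * norm (x - p x)"
proof -
  have "lam * mu * norm (p x - c) \<le> norm (F x)"
  proof (cases "p x = c")
    case False
    have "lam * mu * (norm (p x - c))\<^sup>2 \<le> - ((p x - c) \<bullet> F x)"
      using inner_F_prox_le[OF assms, of x] by linarith
    also have "\<dots> \<le> norm (p x - c) * norm (F x)"
      using Cauchy_Schwarz_ineq2[of "p x - c" "F x"] by linarith
    finally have "norm (p x - c) * (lam * mu * norm (p x - c)) \<le> norm (p x - c) * norm (F x)"
      by (simp add: power2_eq_square mult_ac)
    then show ?thesis
      using False by simp
  qed simp
  also have "\<dots> \<le> norm (x - p x) + lam * \<beta> * norm (x - p x)"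
    unfolding F_eq using norm_triangle_ineq[of "p x - x"] scaled_T_lipschitz[of x "p x"]
    by (smt (verit) norm_minus_commute)
  finally have "lam * mu * norm (p x - c) \<le> norm (x - p x) + lam * \<beta> * norm (x - p x)" .
  moreover have "lam * mu * norm (x - c) \<le> lam * mu * (norm (x - p x) + norm (p x - c))"
    using norm_triangle_ineq[of "x - p x" "p x - c"] lam_pos mu_pos by (intro mult_left_mono) auto
  ultimately show ?thesis
    by (simp add: algebra_simps)
qed

text \<open>Split \<open>x - c\<close> at \<open>p x\<close>: the part from \<open>p x\<close> to
  \<open>c\<close> contributes nothing positive, and on the other part the Lipschitz correction
  costs only a fraction \<open>lam * \<beta>\<close> of the square.\<close>

lemma inner_F_le:
  assumes "mvi_solution C h T c"
  shows "(x - c) \<bullet> F x \<le> - ((1 - lam * \<beta>) * (norm (x - p x))\<^sup>2)"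
proof -
  have "(x - p x) \<bullet> (lam *\<^sub>R (T x - T (p x))) \<le> norm (x - p x) * (lam * \<beta> * norm (x - p x))"
    using scaled_T_lipschitz by (rule order.trans[OF norm_cauchy_schwarz mult_left_mono]) auto
  moreover have "(x - p x) \<bullet> F x = - (norm (x - p x))\<^sup>2 + (x - p x) \<bullet> (lam *\<^sub>R (T x - T (p x)))"
    unfolding F_eq power2_norm_eq_inner inner_add_right
    by (simp add: inner_diff algebra_simps)
  ultimately have "(x - p x) \<bullet> F x \<le> - ((1 - lam * \<beta>) * (norm (x - p x))\<^sup>2)"
    by (simp add: power2_eq_square algebra_simps)
  moreover have "(p x - c) \<bullet> F x \<le> 0"
    using inner_F_prox_le[OF assms, of x] lam_pos mu_pos
    by (smt (verit) mult_nonneg_nonneg zero_le_power2)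
  moreover have "(x - c) \<bullet> F x = (x - p x) \<bullet> F x + (p x - c) \<bullet> F x"
    by (simp add: inner_diff_left)
  ultimately show ?thesis by linarith
qed

text \<open>\<open>\<kappa>\<close> may lie below \<open>1 - lam * \<beta>\<close> so that the rate
  can be stated with \<open>1 - lam * (1 + \<beta>\<^sup>2)\<close>.\<close>

lemma dissipation:
  assumes "mvi_solution C h T c" and "0 \<le> \<kappa>" "\<kappa> \<le> 1 - lam * \<beta>"
  shows "(x - c) \<bullet> F x \<le> - (\<kappa> * (lam * mu / (1 + lam * (mu + \<beta>)))\<^sup>2) * (norm (x - c))\<^sup>2"
proof -
  have pos: "1 + lam * (mu + \<beta>) > 0"
    using lam_pos mu_pos beta_nonneg by (intro add_pos_nonneg) auto
  then have "lam * mu / (1 + lam * (mu + \<beta>)) * norm (x - c) \<le> norm (x - p x)"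
    using error_bound[OF assms(1), of x] by (simp add: field_simps)
  then have "(lam * mu / (1 + lam * (mu + \<beta>)) * norm (x - c))\<^sup>2 \<le> (norm (x - p x))\<^sup>2"
    using pos lam_pos mu_pos by (intro power_mono) auto
  then have "\<kappa> * (lam * mu / (1 + lam * (mu + \<beta>)) * norm (x - c))\<^sup>2 \<le> (1 - lam * \<beta>) * (norm (x - p x))\<^sup>2"
    using assms(2,3) by (intro mult_mono) auto
  then show ?thesis
    using inner_F_le[OF assms(1), of x]
    unfolding power_mult_distrib[of _ "norm (x - c)"] mult.assoc mult_minus_left by linarith
qed

end

end

theorem theorem3p7:
  fixes C :: "'a::{real_inner, complete_space} set"
    and h :: "'a \<Rightarrow> ereal"
    and T :: "'a \<Rightarrow> 'a"
    and mu \<beta> lam :: real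
  assumes "C \<noteq> {}" and "closed C" and "convex C"
    and "proper_on C h" and "lower_semicont_on C h" and "ereal_convex_on C h"
    and "mu > 0" and "strongly_pseudomonotone_wrt C h T mu"
    and "\<beta> > 0" and "lipschitz_on \<beta> UNIV T"
    and "0 < lam" and "lam < 1 / (1 + \<beta>\<^sup>2)"
  defines "\<alpha> \<equiv> 2 * (1 - lam * (1 + \<beta>\<^sup>2)) * (lam * mu / (1 + lam * (mu + \<beta>)))\<^sup>2"
  shows "\<exists>c. (\<forall>d. mvi_solution C h T d \<longleftrightarrow> d = c) \<and>
             (\<forall>d. equilibrium_point (fbf_field C h T lam) d \<longleftrightarrow> d = c) \<and>
             globally_exponentially_stable (fbf_field C h T lam) c \<and>
             (\<forall>x0 x. strong_global_solution (fbf_field C h T lam) x0 x \<longrightarrow>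
                (\<forall>t\<ge>0. (norm (x t - c))\<^sup>2 \<le> (norm (x 0 - c))\<^sup>2 * exp (- \<alpha> * t)))"
proof -
  interpret strongly_pseudomonotone_mvi C h T mu \<beta>
    using assms by unfold_locales
  define \<kappa> where "\<kappa> = 1 - lam * (1 + \<beta>\<^sup>2)"
  define q where "q = lam * mu / (1 + lam * (mu + \<beta>))"
  have "1 + \<beta>\<^sup>2 > 0"
    by (simp add: add_pos_nonneg)
  then have "\<kappa> > 0"
    using \<open>lam < 1 / (1 + \<beta>\<^sup>2)\<close> by (simp add: \<kappa>_def field_simps)
  \<comment> \<open>Yields \<open>\<beta> \<le> \<beta>\<^sup>2 + 1/4\<close>, which links the
    step-size condition to \<open>lam * \<beta> < 1\<close>.\<close>
  have "0 \<le> (\<beta> - 1/2)\<^sup>2" by simp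
  then have "\<beta> \<le> 1 + \<beta>\<^sup>2"
    by (simp add: power2_eq_square algebra_simps)
  then have "lam * \<beta> \<le> lam * (1 + \<beta>\<^sup>2)"
    using \<open>0 < lam\<close> by simp
  then have \<kappa>_le: "\<kappa> \<le> 1 - lam * \<beta>" and lam_beta: "lam * \<beta> < 1"
    using \<open>\<kappa> > 0\<close> by (auto simp: \<kappa>_def)
  have "q > 0"
    using \<open>0 < lam\<close> \<open>mu > 0\<close> \<open>\<beta> > 0\<close> by (simp add: q_def add_pos_pos)
  have \<alpha>: "\<alpha> = 2 * (\<kappa> * q\<^sup>2)"
    by (simp add: \<alpha>_def \<kappa>_def q_def)
  then have "\<alpha> > 0"
    using \<open>\<kappa> > 0\<close> \<open>q > 0\<close> by simp
  obtain c where c: "mvi_solution C h T c"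
    using ex_mvi_solution by blast
  have mvi: "mvi_solution C h T d \<longleftrightarrow> d = c" for d
    using c mvi_solution_unique by blast
  have eq: "equilibrium_point (fbf_field C h T lam) d \<longleftrightarrow> d = c" for d
    using equilibrium_point_iff_mvi_solution[OF \<open>0 < lam\<close> lam_beta] mvi by simp
  have diss: "(z - c) \<bullet> fbf_field C h T lam z \<le> - (\<alpha> / 2) * (norm (z - c))\<^sup>2" for z
    using dissipation[OF \<open>0 < lam\<close> lam_beta c less_imp_le[OF \<open>\<kappa> > 0\<close>] \<kappa>_le, of z]
    by (simp add: \<alpha> q_def)
  have decay: "(norm (x t - c))\<^sup>2 \<le> (norm (x 0 - c))\<^sup>2 * exp (- \<alpha> * t)"
    if "strong_global_solution (fbf_field C h T lam) x0 x" "t \<ge> 0" for x0 x t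
    using strong_global_solution_exp_decay[OF that(1) diss] \<open>\<alpha> > 0\<close> that(2) by simp
  \<comment> \<open>Taking square roots of \<open>decay\<close> halves the rate, so stability holds
    with constants 1 and \<open>\<alpha> / 2\<close>.\<close>
  have "norm (x t - c) \<le> 1 * norm (x 0 - c) * exp (- (\<alpha> / 2) * t)"
    if "strong_global_solution (fbf_field C h T lam) x0 x" "t \<ge> 0" for x0 x t
  proof (rule power2_le_imp_le)
    have "(norm (x 0 - c) * exp (- (\<alpha> / 2) * t))\<^sup>2 = (norm (x 0 - c))\<^sup>2 * exp (- \<alpha> * t)"
      by (simp add: power_mult_distrib flip: exp_of_nat_mult)
    then show "(norm (x t - c))\<^sup>2 \<le> (1 * norm (x 0 - c) * exp (- (\<alpha> / 2) * t))\<^sup>2"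
      using decay[OF that] by simp
  qed simp
  then have "globally_exponentially_stable (fbf_field C h T lam) c"
    unfolding globally_exponentially_stable_def using eq \<open>\<alpha> > 0\<close>
    by (intro conjI exI[of _ 1] exI[of _ "\<alpha> / 2"]) auto
  then show ?thesis
    using mvi eq decay by blast
qed

end
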